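(* Let $n$ be a positive integer. Let $\mathcal S_{n-2}$ be a set containing exactly one graph from each isomorphism class of (g4- or proper) snarks on $n-2$ vertices, and fix any canonical choice function (as defined in the context). Run the following algorithm: Step 1: For each $H\in\mathcal S_{n-2}$, partition the edge-doubling operations $C(\{e_1,e_2,e_3\})$ applicable to $H$ into equivalence classes, and apply exactly one operation from each equivalence class to $H$. Step 2: A graph $G'$ obtained from $H$ in Step 1 by an operation $C(\{e_1,e_2,e_3\})$ is accepted if and only if $G'$ is class 2 and the edge pair defining the corresponding reduction $C^{-1}(\{e_1,e_2,e_3\})$ lies in the orbit of edge pairs of $G'$ chosen by the canonical choice function. Then the algorithm accepts exactly one graph from each isomorphism class of g4-snarks on $n$ vertices. That is, every accepted graph is a g4-snark on $n$ vertices, and for every g4-snark $G$ on $n$ vertices there is exactly one operation performed in Step 1 (over all $H\in\mathcal S_{n-2}$) whose result is isomorphic to $G$ and is accepted in Step 2.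
   Context: All graphs are finite and simple. A cubic graph is class 1 (colourable) if its edges can be properly coloured with 3 colours, and class 2 (uncolourable) otherwise. A cyclic edge cut is a set of edges whose removal leaves a graph with at least two components containing a cycle; a cubic graph is cyclically $k$-connected if it has no cyclic edge cut with fewer than $k$ edges. A g4-snark is a cyclically 4-connected class 2 cubic graph of girth exactly 4. A proper snark is a cyclically 4-connected class 2 cubic graph of girth at least 5. A snark is a graph that is a g4-snark or a proper snark. Edge-doubling operation: let $e_1,e_2,e_3$ be the edges (in this order) of a path in a cubic graph $H$ of girth at least 4. The operation $C(\{e_1,e_2,e_3\})$ subdivides $e_1$ and $e_3$ by one new vertex each and joins the two new vertices by a new edge. This creates a 4-cycle in which the new edge and $e_2$ are opposite edges. Edge pairs and reductions: an edge pair is a set $\{e'_1,e'_2\}$ of two edges that are opposite in a 4-cycle. The reduction $R(\{e'_1,e'_2\})$ removes one of the two edges $e'_1,e'_2$ and suppresses the two resulting vertices of degree 2, i.e. replaces each of them, with its two incident edges, by an edge joining its two neighbours (up to isomorphism, the result does not depend on which of the two edges is removed). The reduction corresponding to $C(\{e_1,e_2,e_3\})$, denoted $C^{-1}(\{e_1,e_2,e_3\})$, is $R(\{e'_1,e'_2\})$ where $e'_1$ is the newly added edge joining the two subdivision vertices and $e'_2=e_2$; $\{e'_1,e'_2\}$ is its defining edge pair. Equivalence of operations: let $C(\{e_1,e_2,e_3\})$ and $C(\{f_1,f_2,f_3\})$ be edge-doubling operations with results $G_C$ and $G'_C$ and with corresponding reductions $R(\{e'_1,e'_2\})$ and $R(\{f'_1,f'_2\})$.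 They are equivalent if there is an isomorphism from $G_C$ to $G'_C$ mapping $\{e'_1,e'_2\}$ onto $\{f'_1,f'_2\}$. Canonical choice function: for a cyclically 4-connected cubic graph $G$ of girth exactly 4, let $E_2(G)$ be the set of all edge pairs $\{e_1,e_2\}$ of $G$ such that the result of $R(\{e_1,e_2\})$ is cyclically 4-connected. A canonical choice function assigns to each such $G$ (with $E_2(G)\neq\emptyset$) an orbit of the automorphism group of $G$ acting on $E_2(G)$, such that whenever $G,G'$ are isomorphic there is an isomorphism from $G$ to $G'$ mapping the orbit chosen for $G$ onto the orbit chosen for $G'$. *)

theory Defs
  imports Main "HOL-Library.Extended_Nat"
begin

datatype 'a ugraph = Graph (verts: "'a set") (edges: "'a set set")

definition simple_graph :: "'a ugraph \<Rightarrow> bool" where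
  "simple_graph G \<longleftrightarrow> finite (verts G) \<and> (\<forall>e\<in>edges G. e \<subseteq> verts G \<and> card e = 2)"

definition neighbours :: "'a ugraph \<Rightarrow> 'a \<Rightarrow> 'a set" where
  "neighbours G v = {w. {v, w} \<in> edges G}"

definition cubic :: "'a ugraph \<Rightarrow> bool" where
  "cubic G \<longleftrightarrow> simple_graph G \<and> (\<forall>v\<in>verts G. card (neighbours G v) = 3)"

definition delete_edges :: "'a ugraph \<Rightarrow> 'a set set \<Rightarrow> 'a ugraph" where
  "delete_edges G F = Graph (verts G) (edges G - F)"

definition is_cycle :: "'a ugraph \<Rightarrow> 'a list \<Rightarrow> bool" where
  "is_cycle G c \<longleftrightarrow> 3 \<le> length c \<and> distinct c \<and>
     (\<forall>i<length c. {c ! i, c ! (Suc i mod length c)} \<in> edges G)"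

text \<open>The girth of an acyclic graph is \<open>\<infinity>\<close>.\<close>

definition girth :: "'a ugraph \<Rightarrow> enat" where
  "girth G = (INF c\<in>{c. is_cycle G c}. enat (length c))"

definition components :: "'a ugraph \<Rightarrow> 'a set set" where
  "components G =
     verts G // {(u, v). u \<in> verts G \<and> v \<in> verts G \<and> (u, v) \<in> {(a, b). {a, b} \<in> edges G}\<^sup>*}"

text \<open>The empty edge set is allowed as a cut, so a disconnected cubic graph is not cyclically
  \<open>k\<close>-connected for any \<open>k \<ge> 1\<close>.\<close>

definition cyclic_edge_cut :: "'a ugraph \<Rightarrow> 'a set set \<Rightarrow> bool" where
  "cyclic_edge_cut G F \<longleftrightarrow> F \<subseteq> edges G \<and>
     2 \<le> card {C \<in> components (delete_edges G F). \<exists>c. is_cycle (delete_edges G F) c \<and> set c \<subseteq> C}"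

definition cyclically_connected :: "nat \<Rightarrow> 'a ugraph \<Rightarrow> bool" where
  "cyclically_connected k G \<longleftrightarrow> cubic G \<and> \<not> (\<exists>F. cyclic_edge_cut G F \<and> card F < k)"

definition class1 :: "'a ugraph \<Rightarrow> bool" where
  "class1 G \<longleftrightarrow> (\<exists>col :: 'a set \<Rightarrow> nat. (\<forall>e\<in>edges G. col e < 3) \<and>
     (\<forall>e\<in>edges G. \<forall>f\<in>edges G. e \<noteq> f \<and> e \<inter> f \<noteq> {} \<longrightarrow> col e \<noteq> col f))"

abbreviation class2 :: "'a ugraph \<Rightarrow> bool" where
  "class2 G \<equiv> \<not> class1 G"

definition g4_snark :: "'a ugraph \<Rightarrow> bool" where
  "g4_snark G \<longleftrightarrow> cubic G \<and> cyclically_connected 4 G \<and> class2 G \<and> girth G = 4"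

definition proper_snark :: "'a ugraph \<Rightarrow> bool" where
  "proper_snark G \<longleftrightarrow> cubic G \<and> cyclically_connected 4 G \<and> class2 G \<and> girth G \<ge> 5"

definition snark :: "'a ugraph \<Rightarrow> bool" where
  "snark G \<longleftrightarrow> g4_snark G \<or> proper_snark G"

definition graph_iso :: "('a \<Rightarrow> 'b) \<Rightarrow> 'a ugraph \<Rightarrow> 'b ugraph \<Rightarrow> bool" where
  "graph_iso f G G' \<longleftrightarrow> bij_betw f (verts G) (verts G') \<and> edges G' = (\<lambda>e. f ` e) ` edges G"

definition isomorphic :: "'a ugraph \<Rightarrow> 'b ugraph \<Rightarrow> bool" where
  "isomorphic G G' \<longleftrightarrow> (\<exists>f. graph_iso f G G')"

text \<open>The map induced by a vertex map on sets of edges, in particular on edge pairs.\<close>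

definition map_edges :: "('a \<Rightarrow> 'b) \<Rightarrow> 'a set set \<Rightarrow> 'b set set" where
  "map_edges f p = (\<lambda>e. f ` e) ` p"

definition edge_pair :: "'a ugraph \<Rightarrow> 'a set set \<Rightarrow> bool" where
  "edge_pair G p \<longleftrightarrow> (\<exists>a b c d. is_cycle G [a, b, c, d] \<and> p = {{a, b}, {c, d}})"

text \<open>For a vertex of degree 2, its set of neighbours is precisely the edge that replaces it.\<close>

definition suppress :: "'a ugraph \<Rightarrow> 'a \<Rightarrow> 'a ugraph" where
  "suppress G v = Graph (verts G - {v}) ({e \<in> edges G. v \<notin> e} \<union> {neighbours G v})"

text \<open>The possible results of the reduction \<open>R(p)\<close>, one for each choice of the edge to be
  removed; if \<open>G\<close> is cubic of girth at least 4, they are isomorphic simple graphs.\<close>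

definition reductions :: "'a ugraph \<Rightarrow> 'a set set \<Rightarrow> 'a ugraph set" where
  "reductions G p =
     {suppress (suppress (delete_edges G {{x, y}}) x) y | x y. {x, y} \<in> p}"

definition E2 :: "'a ugraph \<Rightarrow> 'a set set set" where
  "E2 G = {p. edge_pair G p \<and> (\<exists>R\<in>reductions G p. cyclically_connected 4 R)}"

definition edge_pair_orbit :: "'a ugraph \<Rightarrow> 'a set set \<Rightarrow> 'a set set set" where
  "edge_pair_orbit G p = {map_edges f p | f. graph_iso f G G}"

definition choice_domain :: "'a ugraph \<Rightarrow> bool" where
  "choice_domain G \<longleftrightarrow> cubic G \<and> cyclically_connected 4 G \<and> girth G = 4 \<and> E2 G \<noteq> {}"

definition canonical_choice :: "('a ugraph \<Rightarrow> 'a set set set) \<Rightarrow> bool" where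
  "canonical_choice \<chi> \<longleftrightarrow>
     (\<forall>G. choice_domain G \<longrightarrow> (\<exists>p\<in>E2 G. \<chi> G = edge_pair_orbit G p)) \<and>
     (\<forall>G G'. choice_domain G \<and> choice_domain G' \<and> isomorphic G G' \<longrightarrow>
        (\<exists>f. graph_iso f G G' \<and> map_edges f ` \<chi> G = \<chi> G'))"

text \<open>\<open>(H, P)\<close> stands for the edge-doubling operation \<open>C(P)\<close> applied to \<open>H\<close>. The path with edge
  set \<open>P\<close> is determined up to reversal, which affects neither the result nor the edge pair.\<close>

type_synonym 'a operation = "'a ugraph \<times> 'a set set"

definition path4 :: "'a ugraph \<Rightarrow> 'a \<Rightarrow> 'a \<Rightarrow> 'a \<Rightarrow> 'a \<Rightarrow> bool" where
  "path4 H a b c d \<longleftrightarrow> distinct [a, b, c, d] \<and>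
     {a, b} \<in> edges H \<and> {b, c} \<in> edges H \<and> {c, d} \<in> edges H"

definition operations :: "'a ugraph \<Rightarrow> 'a operation set" where
  "operations H = {(H, P) | P. cubic H \<and> girth H \<ge> 4 \<and>
     (\<exists>a b c d. path4 H a b c d \<and> P = {{a, b}, {b, c}, {c, d}})}"

text \<open>\<open>edge_doubling (H, P) G p\<close>: \<open>G\<close> is a result of \<open>C(P)\<close> applied to \<open>H\<close>, for some choice \<open>x, y\<close>
  of the names of the two new vertices, and \<open>p\<close> is the edge pair defining the corresponding
  reduction of \<open>G\<close>.\<close>

definition edge_doubling :: "'a operation \<Rightarrow> 'a ugraph \<Rightarrow> 'a set set \<Rightarrow> bool" where
  "edge_doubling C G p \<longleftrightarrow> (\<exists>H a b c d x y.
     C = (H, {{a, b}, {b, c}, {c, d}}) \<and> path4 H a b c d \<and>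
     x \<notin> verts H \<and> y \<notin> verts H \<and> x \<noteq> y \<and>
     G = Graph (verts H \<union> {x, y})
               (edges H - {{a, b}, {c, d}} \<union> {{a, x}, {x, b}, {c, y}, {y, d}, {x, y}}) \<and>
     p = {{x, y}, {b, c}})"

definition equiv_operations :: "('a operation \<times> 'a operation) set" where
  "equiv_operations = {(C, D). \<exists>G p G' q f.
     edge_doubling C G p \<and> edge_doubling D G' q \<and> graph_iso f G G' \<and> map_edges f p = q}"

definition operation_classes :: "'a ugraph \<Rightarrow> 'a operation set set" where
  "operation_classes H =
     operations H // (equiv_operations \<inter> operations H \<times> operations H)"

text \<open>There is no snark with \<open>m = 0\<close> vertices (the empty graph is class 1), so truncated
  subtraction is harmless when this is used with \<open>m = n - 2\<close> and \<open>n < 2\<close>.\<close>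

definition snark_representatives :: "nat \<Rightarrow> 'a ugraph set \<Rightarrow> bool" where
  "snark_representatives m S \<longleftrightarrow>
     (\<forall>H\<in>S. snark H \<and> card (verts H) = m) \<and>
     (\<forall>H :: 'a ugraph. snark H \<and> card (verts H) = m \<longrightarrow> (\<exists>!H'. H' \<in> S \<and> isomorphic H H'))"

text \<open>\<open>T\<close> is a possible set of operations performed when starting from the graphs in \<open>S\<close>.\<close>

definition operation_representatives :: "'a ugraph set \<Rightarrow> 'a operation set \<Rightarrow> bool" where
  "operation_representatives S T \<longleftrightarrow>
     T \<subseteq> (\<Union>H\<in>S. operations H) \<and>
     (\<forall>H\<in>S. \<forall>K\<in>operation_classes H. \<exists>!C. C \<in> T \<inter> K)"

definition accepted ::
  "('a ugraph \<Rightarrow> 'a set set set) \<Rightarrow> 'a ugraph \<Rightarrow> 'a set set \<Rightarrow> bool" where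
  "accepted \<chi> G' p \<longleftrightarrow> class2 G' \<and> p \<in> \<chi> G'"

end

theory Submission
  imports Defs
begin

text \<open>In a cubic graph, a side of a cut with at most three edges contains a cycle as soon as it has
  two vertices, so cyclic 4-connectivity only concerns the sizes of cuts and is seen to survive edge
  doubling. If two accepted operations have isomorphic results, an automorphism makes the
  isomorphism respect the defining edge pairs, as both lie in the chosen orbit; hence the two
  operations start from the same graph and are equivalent.

  For existence, let \<open>G\<close> be a g4-snark. Some edge pair of \<open>G\<close> has a cyclically 4-connected
  reduction: otherwise both directions of a 4-cycle are separated by a cut of size 4, and
  submodularity forces the two crossing cuts to split \<open>G\<close> into four pairs of vertices, so that \<open>G\<close>
  is the cube, which is class 1. A reduction of \<open>G\<close> is class 2, because a 3-edge-colouring of it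
  extends to \<open>G\<close>, possibly after a Kempe exchange. So the edge pair in the chosen orbit comes from
  doubling a snark on two vertices fewer.\<close>

section \<open>Edge cuts and cyclic connectivity\<close>

text \<open>A defining edge pair is an unordered set, so an isomorphism of results may exchange the
  new edge with the middle edge of the path. The starting graph is still recovered, because removing
  either edge of the pair gives isomorphic graphs (\<open>reduced_bc_iso\<close>). Membership in
  \<open>E2\<close> only promises a cyclically 4-connected reduction, whereas edge doubling
  presupposes girth at least 4. The girth is regained from class 2, which excludes triangles in a
  tight cubic graph. A reduction is treated as the graph from which \<open>G\<close> itself arises
  by doubling (\<open>subdivided_reduced\<close>), with the ends of the removed edge as the new
  vertices; thus one cut formula, \<open>cut_G\<close>, serves both directions. The number 4 in the
  crossing argument has this origin: a bad cut of a reduction has at most three edges, and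
  reinserting the removed edge makes it at most four. Two such cuts give at most 8 for each pair of
  opposite quadrants, while each quadrant needs 4. No slack is left, and this is what pins every
  quadrant down to two vertices.\<close>

definition triangle_free :: "'a ugraph \<Rightarrow> bool" where
  "triangle_free G \<longleftrightarrow> (\<forall>u v. {u, v} \<in> edges G \<longrightarrow> neighbours G u \<inter> neighbours G v = {})"

definition edge_cut :: "'a ugraph \<Rightarrow> 'a set \<Rightarrow> 'a set set" where
  "edge_cut G A = {e \<in> edges G. e \<inter> A \<noteq> {} \<and> e - A \<noteq> {}}"

text \<open>Cyclic 4-connectivity without cycles and components. The threshold 2 is the least
  possible one, since a single vertex of a cubic graph has a cut of three edges.\<close>

definition tight :: "'a ugraph \<Rightarrow> bool" where
  "tight G \<longleftrightarrow> (\<forall>A\<subseteq>verts G. 2 \<le> card A \<and> 2 \<le> card (verts G - A) \<longrightarrow> 4 \<le> card (edge_cut G A))"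

lemma graph_eqI: "verts G = verts H \<Longrightarrow> edges G = edges H \<Longrightarrow> G = H"
  by (cases G; cases H) simp

lemma mem_neighbours [simp]: "w \<in> neighbours G v \<longleftrightarrow> {v, w} \<in> edges G"
  by (simp add: neighbours_def)

lemma edge_ex:
  "simple_graph G \<Longrightarrow> e \<in> edges G \<Longrightarrow> \<exists>u v. e = {u, v}"
  unfolding simple_graph_def by (metis card_2_iff)

lemma edge_verts:
  assumes "simple_graph G" "{u, v} \<in> edges G"
  shows "u \<in> verts G" "v \<in> verts G" "u \<noteq> v"
  using assms by (auto simp: simple_graph_def card_2_iff)

lemma neighbours_subset: "simple_graph G \<Longrightarrow> neighbours G v \<subseteq> verts G"
  using edge_verts(2) by fastforce

lemma not_self_neighbour: "simple_graph G \<Longrightarrow> v \<notin> neighbours G v"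
  using edge_verts(3)[of G v v] by auto

lemma finite_verts: "simple_graph G \<Longrightarrow> finite (verts G)"
  by (simp add: simple_graph_def)

lemma finite_neighbours: "simple_graph G \<Longrightarrow> finite (neighbours G v)"
  by (rule finite_subset[OF neighbours_subset finite_verts])

lemma finite_edges: "simple_graph G \<Longrightarrow> finite (edges G)"
  by (rule finite_subset[of _ "Pow (verts G)"]) (auto simp: simple_graph_def)

lemma finite_cut: "simple_graph G \<Longrightarrow> finite (edge_cut G A)"
  by (simp add: edge_cut_def finite_edges)

lemma cubic_simple: "cubic G \<Longrightarrow> simple_graph G"
  by (simp add: cubic_def)

lemma cubic_card_neighbours: "cubic G \<Longrightarrow> v \<in> verts G \<Longrightarrow> card (neighbours G v) = 3"
  by (simp add: cubic_def)

lemma all_less_3_4: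
  "(\<forall>i<Suc (Suc (Suc 0)). P i) \<longleftrightarrow> P 0 \<and> P 1 \<and> P (2::nat)"
  "(\<forall>i<Suc (Suc (Suc (Suc 0))). P i) \<longleftrightarrow> P 0 \<and> P 1 \<and> P 2 \<and> P (3::nat)"
  by (auto simp: numeral_eq_Suc All_less_Suc)

lemma is_cycle3:
  "is_cycle G [a, b, c] \<longleftrightarrow> distinct [a, b, c] \<and> {a, b} \<in> edges G \<and> {b, c} \<in> edges G \<and> {c, a} \<in> edges G"
  by (simp add: is_cycle_def all_less_3_4)

lemma is_cycle4:
  "is_cycle G [a, b, c, d] \<longleftrightarrow> distinct [a, b, c, d] \<and> {a, b} \<in> edges G \<and> {b, c} \<in> edges G
     \<and> {c, d} \<in> edges G \<and> {d, a} \<in> edges G"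
  by (simp add: is_cycle_def all_less_3_4)

section \<open>Girth at least 4 and girth exactly 4\<close>

lemma triangle_free_iff_girth:
  assumes "simple_graph G"
  shows "triangle_free G \<longleftrightarrow> 4 \<le> girth G"
proof
  assume tf: "triangle_free G"
  have "4 \<le> length c" if c: "is_cycle G c" for c
  proof (rule ccontr)
    assume "\<not> 4 \<le> length c"
    then have "length c = 3" using c by (auto simp: is_cycle_def)
    then obtain p q r where "c = [p, q, r]"
      by (auto simp: length_Suc_conv numeral_3_eq_3)
    then have "{p, q} \<in> edges G" "r \<in> neighbours G p \<inter> neighbours G q"
      using c by (auto simp: is_cycle3 insert_commute)
    then show False using tf unfolding triangle_free_def by blast
  qed
  then show "4 \<le> girth G"
    by (auto simp: girth_def le_INF_iff numeral_eq_enat)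
next
  assume g: "4 \<le> girth G"
  show "triangle_free G" unfolding triangle_free_def
  proof (intro allI impI equals0I)
    fix u v w assume uv: "{u, v} \<in> edges G" and w: "w \<in> neighbours G u \<inter> neighbours G v"
    then have "is_cycle G [u, v, w]"
      using edge_verts(3)[OF assms] by (auto simp: is_cycle3 insert_commute)
    then have "girth G \<le> enat 3" unfolding girth_def by (intro INF_lower2) auto
    then have "4 \<le> enat 3" using g order_trans by blast
    then show False by (simp add: numeral_eq_enat)
  qed
qed

lemma girth_eq4I:
  assumes "simple_graph G" "triangle_free G" "is_cycle G [a, b, c, d]"
  shows "girth G = 4"
proof (rule antisym)
  show "girth G \<le> 4" unfolding girth_def
    using assms(3) by (intro INF_lower2[of "[a, b, c, d]"]) (auto simp: numeral_eq_enat)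
qed (use assms triangle_free_iff_girth in blast)

text \<open>An infimum over a nonempty set of extended naturals is its least element, so the girth
  is attained by a cycle; without any cycle it would be infinite.\<close>

lemma girth4_cycle:
  assumes "girth G = 4"
  obtains a b c d where "is_cycle G [a, b, c, d]"
proof -
  have "\<exists>c. is_cycle G c \<and> length c = 4"
  proof (rule ccontr)
    assume no: "\<nexists>c. is_cycle G c \<and> length c = 4"
    have "girth G \<noteq> (INF c\<in>{c. is_cycle G c}. enat (length c))" 
    proof (cases "{c. is_cycle G c} = {}")
      case True
      then show ?thesis using assms by (simp add: top_enat_def numeral_eq_enat)
    next
      case False
      then obtain z where "z \<in> (\<lambda>c. enat (length c)) ` {c. is_cycle G c}" by blast
      from LeastI[of "\<lambda>x. x \<in> (\<lambda>c. enat (length c)) ` {c. is_cycle G c}", OF this]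
      have "(INF c\<in>{c. is_cycle G c}. enat (length c)) \<in> (\<lambda>c. enat (length c)) ` {c. is_cycle G c}"
        using False by (simp add: Inf_enat_def)
      then show ?thesis using no assms by (auto simp: numeral_eq_enat)
    qed
    then show False by (simp add: girth_def)
  qed
  then show thesis using that by (auto simp: length_Suc_conv numeral_eq_Suc)
qed

text \<open>Orienting every cut edge from its end in \<open>A\<close> to its end outside turns the
  cut into a disjoint union over \<open>A\<close>.\<close>

lemma card_cut:
  assumes "simple_graph G" "A \<subseteq> verts G"
  shows "card (edge_cut G A) = (\<Sum>u\<in>A. card (neighbours G u - A))"
proof -
  let ?D = "SIGMA u:A. neighbours G u - A"
  have "bij_betw (\<lambda>(u, w). {u, w}) ?D (edge_cut G A)"
  proof (rule bij_betw_imageI)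
    show "inj_on (\<lambda>(u, w). {u, w}) ?D"
      by (auto simp: inj_on_def doubleton_eq_iff)
    show "(\<lambda>(u, w). {u, w}) ` ?D = edge_cut G A"
    proof
      show "(\<lambda>(u, w). {u, w}) ` ?D \<subseteq> edge_cut G A"
        by (auto simp: edge_cut_def)
      show "edge_cut G A \<subseteq> (\<lambda>(u, w). {u, w}) ` ?D"
      proof
        fix e assume e: "e \<in> edge_cut G A"
        then obtain u v where uv: "e = {u, v}"
          using edge_ex[OF assms(1), of e] by (auto simp: edge_cut_def)
        then show "e \<in> (\<lambda>(u, w). {u, w}) ` ?D"
        proof (cases "u \<in> A")
          case True
          then have "(u, v) \<in> ?D" using e uv by (auto simp: edge_cut_def)
          then show ?thesis using uv by force
        next
          case False
          then have "(v, u) \<in> ?D" using e uv by (auto simp: edge_cut_def insert_commute)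
          then show ?thesis using uv by force
        qed
      qed
    qed
  qed
  then have "card (edge_cut G A) = card ?D" by (simp add: bij_betw_same_card)
  also have "\<dots> = (\<Sum>u\<in>A. card (neighbours G u - A))"
    using finite_subset[OF assms(2) finite_verts[OF assms(1)]] finite_neighbours[OF assms(1)]
    by (intro card_SigmaI) auto
  finally show ?thesis .
qed

lemma cut_compl: "simple_graph G \<Longrightarrow> edge_cut G (verts G - A) = edge_cut G A"
  by (auto simp: edge_cut_def simple_graph_def)

text \<open>An edge that is in both cuts on the left joins \<open>A \<inter> B\<close> to the
  outside of \<open>A \<union> B\<close> and therefore crosses \<open>A\<close> and \<open>B\<close>
  as well; an edge in only one of them still crosses at least one of the two sets.\<close>

lemma cut_submodular:
  assumes "simple_graph G"
  shows "card (edge_cut G (A \<inter> B)) + card (edge_cut G (A \<union> B)) \<le> card (edge_cut G A) + card (edge_cut G B)"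
proof -
  have "card (edge_cut G (A \<inter> B)) + card (edge_cut G (A \<union> B)) =
        card (edge_cut G (A \<inter> B) \<union> edge_cut G (A \<union> B)) + card (edge_cut G (A \<inter> B) \<inter> edge_cut G (A \<union> B))"
    by (intro card_Un_Int finite_cut assms)
  also have "\<dots> \<le> card (edge_cut G A \<union> edge_cut G B) + card (edge_cut G A \<inter> edge_cut G B)"
  proof (intro add_mono card_mono)
    show "edge_cut G (A \<inter> B) \<union> edge_cut G (A \<union> B) \<subseteq> edge_cut G A \<union> edge_cut G B"
      by (auto simp: edge_cut_def)
    show "edge_cut G (A \<inter> B) \<inter> edge_cut G (A \<union> B) \<subseteq> edge_cut G A \<inter> edge_cut G B"
    proof
      fix e assume e: "e \<in> edge_cut G (A \<inter> B) \<inter> edge_cut G (A \<union> B)"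
      then show "e \<in> edge_cut G A \<inter> edge_cut G B"
        by (auto simp: edge_cut_def)
    qed
  qed (use assms finite_cut in auto)
  also have "\<dots> = card (edge_cut G A) + card (edge_cut G B)"
    by (intro card_Un_Int[symmetric] finite_cut assms)
  finally show ?thesis .
qed

text \<open>When \<open>v\<close> leaves \<open>A\<close>, its edges to the outside stop crossing
  and its edges into \<open>A\<close> start crossing. Both counts are added rather than subtracted
  to stay within the naturals.\<close>

lemma card_cut_remove:
  assumes "simple_graph G" "A \<subseteq> verts G" "v \<in> A"
  shows "card (edge_cut G (A - {v})) + card (neighbours G v - A) = card (edge_cut G A) + card (neighbours G v \<inter> A)"
proof -
  let ?N = "neighbours G"
  have fA: "finite A" using finite_subset[OF assms(2) finite_verts[OF assms(1)]] .
  have vN: "v \<notin> ?N v" using not_self_neighbour[OF assms(1)] .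
  have "card (?N u - (A - {v})) = card (?N u - A) + (if v \<in> ?N u then 1 else 0)" if "u \<in> A - {v}" for u
  proof -
    have "?N u - (A - {v}) = (if v \<in> ?N u then insert v (?N u - A) else ?N u - A)"
      using assms(3) by auto
    then show ?thesis using assms(3) finite_neighbours[OF assms(1)] by auto
  qed
  then have "card (edge_cut G (A - {v})) = (\<Sum>u\<in>A - {v}. card (?N u - A) + (if v \<in> ?N u then 1 else 0))"
    using assms by (subst card_cut) auto
  also have "\<dots> = (\<Sum>u\<in>A - {v}. card (?N u - A)) + card {u \<in> A - {v}. v \<in> ?N u}"
    using fA by (simp add: sum.distrib sum.If_cases Int_def del: mem_neighbours)
  also have "{u \<in> A - {v}. v \<in> ?N u} = ?N v \<inter> A"
    using vN by (auto simp: insert_commute)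
  finally have "card (edge_cut G (A - {v})) + card (?N v - A)
      = card (?N v - A) + (\<Sum>u\<in>A - {v}. card (?N u - A)) + card (?N v \<inter> A)" by simp
  also have "\<dots> = card (edge_cut G A) + card (?N v \<inter> A)"
    using fA assms by (simp add: card_cut sum.remove)
  finally show ?thesis .
qed

lemma card_cut_singleton:
  assumes "cubic G" "v \<in> verts G"
  shows "card (edge_cut G {v}) = 3"
  using assms not_self_neighbour[OF cubic_simple[OF assms(1)], of v]
  by (simp add: card_cut cubic_simple cubic_card_neighbours)

text \<open>A longest path starting in \<open>A\<close> closes up to a cycle at its first vertex.\<close>

lemma cycle_in_min_degree2:
  assumes "simple_graph G" "A \<subseteq> verts G" "A \<noteq> {}"
    and deg: "\<And>v. v \<in> A \<Longrightarrow> 2 \<le> card (neighbours G v \<inter> A)"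
  obtains c where "is_cycle G c" "set c \<subseteq> A"
proof -
  define P where "P p \<longleftrightarrow> distinct p \<and> p \<noteq> [] \<and> set p \<subseteq> A \<and>
    (\<forall>i. Suc i < length p \<longrightarrow> {p ! i, p ! Suc i} \<in> edges G)" for p
  have fA: "finite A" using finite_subset[OF assms(2) finite_verts[OF assms(1)]] .
  obtain a where "a \<in> A" using assms by blast
  then have "P [a]" by (simp add: P_def)
  moreover have "length p < Suc (card A)" if "P p" for p
    using that card_mono[OF fA, of "set p"] distinct_card[of p] by (simp add: P_def)
  ultimately obtain p where p: "P p" and max: "\<And>q. P q \<Longrightarrow> length q \<le> length p"
    using ex_has_greatest_nat[of P "[a]" length "Suc (card A)"] by (metis less_imp_le)
  let ?v = "p ! 0"
  have len: "0 < length p" using p by (simp add: P_def)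
  have v: "?v \<in> A" using p len by (auto simp: P_def)
  have sub: "neighbours G ?v \<inter> A \<subseteq> set p"
  proof
    fix w assume w: "w \<in> neighbours G ?v \<inter> A"
    show "w \<in> set p"
    proof (rule ccontr)
      assume "w \<notin> set p"
      then have "P (w # p)" using p w
        by (auto simp: P_def nth_Cons insert_commute split: nat.splits)
      then show False using max by fastforce
    qed
  qed
  \<comment> \<open>If \<open>p\<close> has a single entry, \<open>p ! 1\<close> is an unspecified
    value; two neighbours in \<open>A\<close> still leave one that differs from it.\<close>
  have "\<exists>w\<in>neighbours G ?v \<inter> A. w \<noteq> p ! 1"
  proof (rule ccontr)
    assume "\<not> ?thesis"
    then have "neighbours G ?v \<inter> A \<subseteq> {p ! 1}" by blast
    from card_mono[OF _ this] deg[OF v] show False by simp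
  qed
  then obtain w where w: "w \<in> neighbours G ?v \<inter> A" "w \<noteq> p ! 1" by blast
  then have "w \<in> set p" using sub by blast
  then obtain j where j: "j < length p" "w = p ! j" by (metis in_set_conv_nth)
  have "j \<noteq> 0" using w j not_self_neighbour[OF assms(1), of ?v] by (intro notI) simp
  moreover have "j \<noteq> 1" using w j by auto
  ultimately have j2: "2 \<le> j" by simp
  let ?c = "take (Suc j) p"
  have "is_cycle G ?c" unfolding is_cycle_def
  proof (intro conjI allI impI)
    show "3 \<le> length ?c" using j j2 by simp
    show "distinct ?c" using p by (simp add: P_def)
    fix i assume i: "i < length ?c"
    show "{?c ! i, ?c ! (Suc i mod length ?c)} \<in> edges G"
    proof (cases "i = j")
      case True
      then show ?thesis using j w by (simp add: insert_commute)
    next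
      case False
      then show ?thesis using i j p by (simp add: P_def)
    qed
  qed
  moreover have "set ?c \<subseteq> A" using p set_take_subset[of "Suc j" p] by (auto simp: P_def)
  ultimately show thesis using that by blast
qed

text \<open>Removing a vertex of degree at most 1 from \<open>A\<close> decreases both sides of the inequality.\<close>

lemma cycle_in_small_cut:
  assumes "cubic G" "A \<subseteq> verts G" "A \<noteq> {}" "card (edge_cut G A) \<le> card A + 1"
  shows "\<exists>c. is_cycle G c \<and> set c \<subseteq> A"
  using assms(2-)
proof (induction "card A" arbitrary: A rule: less_induct)
  case (less A)
  have G: "simple_graph G" using assms(1) by (rule cubic_simple)
  have fA: "finite A" using finite_subset[OF less.prems(1) finite_verts[OF G]] .
  show ?case
  proof (cases "\<forall>v\<in>A. 2 \<le> card (neighbours G v \<inter> A)")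
    case True
    then show ?thesis using cycle_in_min_degree2[OF G less.prems(1,2)] by metis
  next
    case False
    then obtain v where v: "v \<in> A" "card (neighbours G v \<inter> A) \<le> 1" by fastforce
    have "card (neighbours G v) = card (neighbours G v \<inter> A) + card (neighbours G v - A)"
      using finite_neighbours[OF G] by (metis card_Int_Diff)
    moreover have "card (neighbours G v) = 3" using v less.prems assms(1) by (auto simp: cubic_def)
    ultimately have "card (edge_cut G (A - {v})) + 1 \<le> card (edge_cut G A)"
      using card_cut_remove[OF G less.prems(1) v(1)] v(2) by linarith
    moreover have c: "card A = Suc (card (A - {v}))" using v fA by (metis card_Suc_Diff1)
    ultimately have "card (edge_cut G (A - {v})) \<le> card (A - {v}) + 1" using less.prems by linarith
    \<comment> \<open>A singleton has a cut of 3 edges, above the bound 1 + 1, so the induction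
      never arrives at the empty set.\<close>
    moreover have "A - {v} \<noteq> {}"
    proof
      assume "A - {v} = {}"
      then have "A = {v}" using v by blast
      then show False using card_cut_singleton[OF assms(1), of v] less.prems by simp
    qed
    ultimately have "\<exists>c. is_cycle G c \<and> set c \<subseteq> A - {v}"
      using less.hyps[of "A - {v}"] c less.prems by auto
    then show ?thesis by blast
  qed
qed

section \<open>Components left by an edge cut\<close>

lemma delete_edges_sel [simp]:
  "verts (delete_edges G F) = verts G" "edges (delete_edges G F) = edges G - F"
  by (simp_all add: delete_edges_def)

lemma component_closed:
  assumes "C \<in> components G" "u \<in> C" "{u, v} \<in> edges G" "simple_graph G"
  shows "v \<in> C"
  using assms edge_verts(2)[OF assms(4,3)] unfolding components_def quotient_def
  by (auto intro: rtrancl_into_rtrancl)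

lemma component_disjoint:
  assumes "C \<in> components G" "D \<in> components G" "C \<noteq> D"
  shows "C \<inter> D = {}"
proof -
  have "sym {(a, b). {a, b} \<in> edges G}" by (auto simp: sym_def insert_commute)
  then have "sym ({(a, b). {a, b} \<in> edges G}\<^sup>*)" by (rule sym_rtrancl)
  then have "equiv (verts G) {(u, v). u \<in> verts G \<and> v \<in> verts G \<and> (u, v) \<in> {(a, b). {a, b} \<in> edges G}\<^sup>*}"
    by (auto simp: equiv_def refl_on_def sym_def trans_def)
  from quotient_disj[OF this] assms show ?thesis unfolding components_def by blast
qed

text \<open>The component is that of the first vertex of \<open>c\<close>: the other vertices are
  reached along the cycle, and closure under edges keeps every walk inside \<open>A\<close>.\<close>

lemma cycle_component:
  assumes c: "is_cycle G c" and A: "set c \<subseteq> A" "A \<subseteq> verts G"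
    and closed: "\<And>u v. u \<in> A \<Longrightarrow> {u, v} \<in> edges G \<Longrightarrow> v \<in> A"
  obtains C where "C \<in> components G" "set c \<subseteq> C" "C \<subseteq> A"
proof -
  let ?r = "{(a, b). {a, b} \<in> edges G}"
  have len: "3 \<le> length c" using c by (simp add: is_cycle_def)
  let ?C = "{(u, v). u \<in> verts G \<and> v \<in> verts G \<and> (u, v) \<in> ?r\<^sup>*} `` {c ! 0}"
  have c0: "c ! 0 \<in> set c" using len by (intro nth_mem) linarith
  have "?C \<in> components G" using A c0 unfolding components_def by (blast intro: quotientI)
  moreover have "(c ! 0, c ! i) \<in> ?r\<^sup>*" if "i < length c" for i
    using that
  proof (induction i)
    case (Suc i)
    then have "{c ! i, c ! Suc i} \<in> edges G" using c unfolding is_cycle_def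
      by (metis Suc_lessD mod_less)
    then show ?case using Suc by (auto intro: rtrancl_into_rtrancl)
  qed simp
  then have "set c \<subseteq> ?C" using A c0 by (fastforce simp: in_set_conv_nth[of _ c] subset_iff)
  moreover have "v \<in> A" if "(c ! 0, v) \<in> ?r\<^sup>*" for v
    using that by (induction) (use A c0 closed in auto)
  then have "?C \<subseteq> A" by auto
  ultimately show thesis using that by blast
qed

lemma tight_iff_cyclically_connected:
  assumes "cubic G"
  shows "cyclically_connected 4 G \<longleftrightarrow> tight G"
proof
  assume cyc: "cyclically_connected 4 G"
  have G: "simple_graph G" using assms by (rule cubic_simple)
  show "tight G" unfolding tight_def
  proof (intro allI impI, rule ccontr)
    fix A assume A: "A \<subseteq> verts G" and cards: "2 \<le> card A \<and> 2 \<le> card (verts G - A)"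
      and small: "\<not> 4 \<le> card (edge_cut G A)"
    let ?B = "verts G - A" and ?G = "delete_edges G (edge_cut G A)"
    let ?S = "{C \<in> components ?G. \<exists>c. is_cycle ?G c \<and> set c \<subseteq> C}"
    \<comment> \<open>Formulated for a general \<open>X\<close> so that it applies to
      \<open>A\<close> and to its complement, which have the same cut.\<close>
    have *: "\<exists>C\<in>?S. C \<subseteq> X \<and> C \<noteq> {}"
      if X: "X \<subseteq> verts G" "2 \<le> card X" "edge_cut G X = edge_cut G A" for X
    proof -
      have "card (edge_cut G X) \<le> card X + 1" using X small by simp
      moreover have "X \<noteq> {}" using X by auto
      ultimately obtain c where c: "is_cycle G c" "set c \<subseteq> X"
        using cycle_in_small_cut[OF assms X(1)] by blast
      have "is_cycle ?G c" unfolding is_cycle_def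
      proof (intro conjI allI impI)
        fix i assume i: "i < length c"
        moreover from i have "Suc i mod length c < length c" by (intro mod_less_divisor) linarith
        ultimately have "c ! i \<in> X" "c ! (Suc i mod length c) \<in> X"
          using c(2) nth_mem by blast+
        then have "{c ! i, c ! (Suc i mod length c)} \<notin> edge_cut G X" by (auto simp: edge_cut_def)
        then show "{c ! i, c ! (Suc i mod length c)} \<in> edges ?G"
          using c i X by (auto simp: is_cycle_def)
      qed (use c in \<open>auto simp: is_cycle_def\<close>)
      moreover have "v \<in> X" if "u \<in> X" "{u, v} \<in> edges ?G" for u v
      proof (rule ccontr)
        assume "v \<notin> X"
        then have "{u, v} \<in> edge_cut G X" using that by (auto simp: edge_cut_def)
        then show False using that X by auto
      qed
      ultimately obtain C where "C \<in> components ?G" "set c \<subseteq> C" "C \<subseteq> X"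
        using cycle_component[of ?G c X] c(2) X(1) by auto
      moreover have "set c \<noteq> {}" using c by (auto simp: is_cycle_def)
      ultimately show ?thesis using \<open>is_cycle ?G c\<close> by (intro bexI[of _ C]) auto
    qed
    obtain C where C: "C \<in> ?S" "C \<subseteq> A" "C \<noteq> {}" using *[of A] A cards by auto
    obtain D where D: "D \<in> ?S" "D \<subseteq> ?B" "D \<noteq> {}" using *[of ?B] cards cut_compl[OF G] by auto
    have "C \<noteq> D" using C D by blast
    have "?S \<subseteq> Pow (verts G)" by (auto simp: components_def quotient_def)
    then have "finite ?S" by (rule finite_subset) (simp add: finite_verts[OF G])
    from card_mono[OF this, of "{C, D}"] have "2 \<le> card ?S" using C D \<open>C \<noteq> D\<close> by auto
    then have "cyclic_edge_cut G (edge_cut G A)" by (auto simp: cyclic_edge_cut_def edge_cut_def)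
    then show False using cyc small unfolding cyclically_connected_def by auto
  qed
next
  assume t: "tight G"
  have G: "simple_graph G" using assms by (rule cubic_simple)
  show "cyclically_connected 4 G" unfolding cyclically_connected_def
  proof (intro conjI assms notI, elim exE conjE)
    fix F assume F: "cyclic_edge_cut G F" and small: "card F < 4"
    let ?G = "delete_edges G F"
    let ?S = "{C \<in> components ?G. \<exists>c. is_cycle ?G c \<and> set c \<subseteq> C}"
    have G': "simple_graph ?G" using G by (auto simp: simple_graph_def)
    have two: "2 \<le> card ?S" using F by (simp add: cyclic_edge_cut_def)
    then have fin: "finite ?S" using card.infinite by force
    \<comment> \<open>All edges leaving \<open>C\<close> lie in \<open>F\<close>, so the cut around
      \<open>C\<close> is small; \<open>D\<close> only serves to make the other side large enough
      for tightness.\<close>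
    obtain C D where CD: "C \<in> ?S" "D \<in> ?S" "C \<noteq> D"
      using two card_le_Suc0_iff_eq[OF fin] by fastforce
    then obtain c d where c: "is_cycle ?G c" "set c \<subseteq> C" and d: "is_cycle ?G d" "set d \<subseteq> D"
      by auto
    have C: "C \<in> components ?G" and D: "D \<in> components ?G" using CD by auto
    then have sub: "C \<subseteq> verts G" "D \<subseteq> verts G"
      by (auto simp: components_def quotient_def)
    have size: "2 \<le> card Y" if "is_cycle ?G c" "set c \<subseteq> Y" "Y \<subseteq> verts G" for c Y
    proof -
      have "finite Y" using finite_subset[OF that(3) finite_verts[OF G]] .
      then have "card (set c) \<le> card Y" using that(2) by (rule card_mono)
      then show ?thesis using that(1) distinct_card[of c] by (auto simp: is_cycle_def)
    qed
    have "C \<inter> D = {}" using component_disjoint[OF C D CD(3)] .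
    then have DC: "D \<subseteq> verts G - C" using sub by auto
    have "4 \<le> card (edge_cut G C)"
      using t sub(1) size[OF c sub(1)] size[OF d(1), of "verts G - C"] d(2) DC
      unfolding tight_def by auto
    moreover have "edge_cut G C \<subseteq> F"
    proof
      fix e assume e: "e \<in> edge_cut G C"
      then obtain u v where uv: "e = {u, v}" using edge_ex[OF G, of e] by (auto simp: edge_cut_def)
      show "e \<in> F"
      proof (rule ccontr)
        assume "e \<notin> F"
        then have "{u, v} \<in> edges ?G" "{v, u} \<in> edges ?G" using e uv by (auto simp: edge_cut_def insert_commute)
        then have "u \<in> C \<longleftrightarrow> v \<in> C" using component_closed[OF C _ _ G'] by metis
        then show False using e uv by (auto simp: edge_cut_def)
      qed
    qed
    then have "card (edge_cut G C) \<le> card F"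
      using F finite_edges[OF G] by (intro card_mono) (auto simp: cyclic_edge_cut_def intro: finite_subset)
    ultimately show False using small by linarith
  qed
qed

section \<open>Edge doubling and reduction\<close>

lemma triangle_free_iff:
  "triangle_free G \<longleftrightarrow> (\<forall>u v w. \<not> ({u, v} \<in> edges G \<and> {v, w} \<in> edges G \<and> {u, w} \<in> edges G))"
  unfolding triangle_free_def disjoint_iff mem_neighbours by metis

lemma card3_obtain:
  assumes "card S = 3" "a \<in> S" "c \<in> S" "a \<noteq> c"
  obtains b where "S = {a, c, b}" "b \<noteq> a" "b \<noteq> c"
proof -
  have "finite S" using assms(1) card.infinite by fastforce
  then have "card (S - {a, c}) = 1" using assms by (subst card_Diff_subset) auto
  then obtain b where "S - {a, c} = {b}" by (auto simp: card_1_singleton_iff)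
  then have "S = {a, c, b}" "b \<noteq> a" "b \<noteq> c" using assms by auto
  then show thesis using that by blast
qed

text \<open>Among two or three vertices without a triangle there are always two that have at most
  one neighbour in the set; each of these sends two edges out.\<close>

lemma card_cut_small:
  assumes G: "cubic G" "triangle_free G" and A: "A \<subseteq> verts G" "2 \<le> card A" "card A \<le> 3"
  shows "4 \<le> card (edge_cut G A)"
proof -
  have sG: "simple_graph G" using G by (simp add: cubic_def)
  let ?N = "neighbours G"
  have fA: "finite A" using finite_subset[OF A(1) finite_verts[OF sG]] .
  have "\<exists>u\<in>A. \<exists>v\<in>A. u \<noteq> v \<and> card (?N u \<inter> A) \<le> 1 \<and> card (?N v \<inter> A) \<le> 1"
  proof (cases "card A = 2")
    case True
    then obtain u v where uv: "A = {u, v}" "u \<noteq> v" by (auto simp: card_2_iff)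
    have "?N u \<inter> A \<subseteq> {v}" "?N v \<inter> A \<subseteq> {u}"
      using uv not_self_neighbour[OF sG] by auto
    from this[THEN card_mono[rotated]] show ?thesis using uv by auto
  next
    case False
    then have "card A = 3" using A by linarith
    then obtain u v w where uvw: "A = {u, v, w}" "u \<noteq> v" "v \<noteq> w" "u \<noteq> w"
      by (auto simp: card_3_iff)
    have *: "card (?N p \<inter> A) \<le> 1 \<and> card (?N q \<inter> A) \<le> 1"
      if "A = {p, q, r}" "{p, q} \<notin> edges G" for p q r
    proof -
      have "?N p \<inter> A \<subseteq> {r}" "?N q \<inter> A \<subseteq> {r}"
        using that not_self_neighbour[OF sG, of p] not_self_neighbour[OF sG, of q]
        by (auto simp: insert_commute)
      from this[THEN card_mono[rotated]] show ?thesis by simp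
    qed
    have "{u, v} \<notin> edges G \<or> {v, w} \<notin> edges G \<or> {u, w} \<notin> edges G"
      using G(2) by (auto simp: triangle_free_iff)
    then show ?thesis
      using *[of u v w] *[of v w u] *[of u w v] uvw by (auto simp: insert_commute)
  qed
  then obtain u v where uv: "u \<in> A" "v \<in> A" "u \<noteq> v" "card (?N u \<inter> A) \<le> 1" "card (?N v \<inter> A) \<le> 1"
    by blast
  have two: "2 \<le> card (?N p - A)" if "p \<in> A" "card (?N p \<inter> A) \<le> 1" for p
  proof -
    have "card (?N p) = 3" using that A(1) G by (auto simp: cubic_def)
    moreover have "card (?N p) = card (?N p \<inter> A) + card (?N p - A)"
      using finite_neighbours[OF sG] by (metis card_Int_Diff)
    ultimately show ?thesis using that by linarith
  qed
  have "4 \<le> (\<Sum>p\<in>{u, v}. card (?N p - A))" using two[of u] two[of v] uv by simp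
  also have "\<dots> \<le> (\<Sum>p\<in>A. card (?N p - A))" using uv fA by (intro sum_mono2) auto
  finally show ?thesis using card_cut[OF sG A(1)] by simp
qed

text \<open>Closed form of the reduction that removes the edge between \<open>x\<close> and
  \<open>y\<close>; unlike two successive suppressions, it is visibly symmetric in them.\<close>

definition reduced :: "'a ugraph \<Rightarrow> 'a \<Rightarrow> 'a \<Rightarrow> 'a ugraph" where
  "reduced G x y = Graph (verts G - {x, y})
     ({e \<in> edges G. x \<notin> e \<and> y \<notin> e} \<union> {neighbours G x - {y}, neighbours G y - {x}})"

lemma reduced_commute: "reduced G x y = reduced G y x"
  by (auto simp: reduced_def insert_commute)

text \<open>The edge created at \<open>x\<close> avoids \<open>y\<close>, so the first suppression
  changes the neighbourhood of \<open>y\<close> only by the loss of \<open>x\<close>.\<close>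

lemma suppress_suppress:
  assumes "x \<noteq> y"
  shows "suppress (suppress (delete_edges G {{x, y}}) x) y = reduced G x y"
proof -
  let ?D = "delete_edges G {{x, y}}"
  let ?S = "suppress ?D x"
  have Nx: "neighbours ?D x = neighbours G x - {y}"
    using assms by (auto simp: doubleton_eq_iff)
  have "{y, w} \<noteq> neighbours G x - {y}" for w by auto
  then have Ny: "neighbours ?S y = neighbours G y - {x}"
    using assms unfolding suppress_def Nx by (auto simp: neighbours_def doubleton_eq_iff)
  show ?thesis
  proof (rule graph_eqI)
    show "verts (suppress ?S y) = verts (reduced G x y)"
      by (auto simp: suppress_def reduced_def)
    have "edges (suppress ?S y) = {e \<in> edges ?S. y \<notin> e} \<union> {neighbours G y - {x}}"
      by (simp add: suppress_def[of ?S] Ny)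
    also have "edges ?S = {e \<in> edges ?D. x \<notin> e} \<union> {neighbours G x - {y}}"
      by (simp add: suppress_def Nx)
    finally show "edges (suppress ?S y) = edges (reduced G x y)"
      by (auto simp: reduced_def)
  qed
qed

text \<open>Kept free of degree and girth conditions so that it also describes how a given graph
  arises from its reduction, whose triangle-freeness is established only afterwards.\<close>

locale subdivided_path =
  fixes H :: "'a ugraph" and a b c d x y :: 'a and G :: "'a ugraph"
  assumes simple_H: "simple_graph H"
    and path: "path4 H a b c d"
    and new: "x \<notin> verts H" "y \<notin> verts H" "x \<noteq> y"
    and G_eq: "G = Graph (verts H \<union> {x, y})
               (edges H - {{a, b}, {c, d}} \<union> {{a, x}, {x, b}, {c, y}, {y, d}, {x, y}})"
begin

lemma verts_G: "verts G = verts H \<union> {x, y}"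
  by (simp add: G_eq)

lemma edges_G: "edges G = edges H - {{a, b}, {c, d}} \<union> {{a, x}, {x, b}, {c, y}, {y, d}, {x, y}}"
  by (simp add: G_eq)

lemma path_edges: "{a, b} \<in> edges H" "{b, c} \<in> edges H" "{c, d} \<in> edges H"
  using path by (auto simp: path4_def)

lemma path_verts: "a \<in> verts H" "b \<in> verts H" "c \<in> verts H" "d \<in> verts H"
  using edge_verts[OF simple_H] path_edges by metis+

lemma path_distinct: "a \<noteq> b" "a \<noteq> c" "a \<noteq> d" "b \<noteq> c" "b \<noteq> d" "c \<noteq> d"
  using path by (auto simp: path4_def)

lemma new_distinct: "x \<noteq> a" "x \<noteq> b" "x \<noteq> c" "x \<noteq> d" "y \<noteq> a" "y \<noteq> b" "y \<noteq> c" "y \<noteq> d" "x \<noteq> y"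
  using new path_verts by auto

lemmas distinct_verts = path_distinct path_distinct[symmetric] new_distinct new_distinct[symmetric]

lemma edge_H_not_new: "e \<in> edges H \<Longrightarrow> x \<notin> e \<and> y \<notin> e"
  using simple_H new by (auto simp: simple_graph_def)

lemma edge_G_iff: "{u, v} \<in> edges G \<longleftrightarrow>
    {u, v} \<in> edges H \<and> {u, v} \<noteq> {a, b} \<and> {u, v} \<noteq> {c, d} \<or>
    {u, v} = {a, x} \<or> {u, v} = {x, b} \<or> {u, v} = {c, y} \<or> {u, v} = {y, d} \<or> {u, v} = {x, y}"
  unfolding edges_G Un_iff Diff_iff insert_iff empty_iff by argo

lemma neighbours_x: "neighbours G x = {a, b, y}"
  using edge_H_not_new[of "{x, _}"] distinct_verts
  by (auto simp: neighbours_def edge_G_iff doubleton_eq_iff)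

lemma neighbours_y: "neighbours G y = {c, d, x}"
  using edge_H_not_new[of "{y, _}"] distinct_verts
  by (auto simp: neighbours_def edge_G_iff doubleton_eq_iff)

lemma neighbours_old:
  assumes "v \<in> verts H"
  shows "neighbours G v =
    (if v = a then insert x (neighbours H a - {b})
     else if v = b then insert x (neighbours H b - {a})
     else if v = c then insert y (neighbours H c - {d})
     else if v = d then insert y (neighbours H d - {c})
     else neighbours H v)"
proof -
  have "v \<noteq> x" "v \<noteq> y" using assms new by auto
  then show ?thesis
    using distinct_verts by (auto simp: neighbours_def edge_G_iff doubleton_eq_iff)
qed

lemma simple_G: "simple_graph G"
proof -
  have "\<forall>e\<in>edges G. e \<subseteq> verts G \<and> card e = 2"
    using simple_H path_verts distinct_verts
    by (auto simp: verts_G edges_G simple_graph_def card_2_iff doubleton_eq_iff)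
  then show ?thesis using finite_verts[OF simple_H] by (simp add: simple_graph_def verts_G)
qed

lemma card_neighbours_old:
  assumes v: "v \<in> verts H"
  shows "card (neighbours G v) = card (neighbours H v)"
proof -
  have sw: "card (insert z (S - {w})) = card S" if "finite S" "w \<in> S" "z \<notin> S" for S :: "'a set" and z w
    using that card_Suc_Diff1[of S w] by simp
  have "x \<notin> neighbours H v" "y \<notin> neighbours H v"
    using edge_H_not_new by auto
  then show ?thesis
    using path_edges finite_neighbours[OF simple_H] unfolding neighbours_old[OF v]
    by (auto intro!: sw simp: insert_commute)
qed

text \<open>An equivalence, because doubling passes cubicity up from \<open>H\<close> while
  reduction passes it down from \<open>G\<close>.\<close>

lemma cubic_iff: "cubic G \<longleftrightarrow> cubic H"
proof -
  have "card (neighbours G x) = 3" "card (neighbours G y) = 3"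
    using distinct_verts by (simp_all add: neighbours_x neighbours_y)
  then show ?thesis
    using simple_G simple_H by (auto simp: cubic_def verts_G card_neighbours_old)
qed

lemma card_verts_G: "card (verts G) = card (verts H) + 2"
  using new finite_verts[OF simple_H] by (simp add: verts_G)

text \<open>All edges other than the two subdivided ones and the five new ones contribute equally to
  both cuts and cancel. Comparing cuts of \<open>G\<close> and \<open>H\<close> thereby becomes a
  Boolean case analysis on six vertices.\<close>

lemma cut_G:
  "card (edge_cut G A) + of_bool (a \<in> A \<longleftrightarrow> b \<notin> A) + of_bool (c \<in> A \<longleftrightarrow> d \<notin> A) =
   card (edge_cut H (A \<inter> verts H)) + of_bool (a \<in> A \<longleftrightarrow> x \<notin> A) + of_bool (x \<in> A \<longleftrightarrow> b \<notin> A) +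
     of_bool (c \<in> A \<longleftrightarrow> y \<notin> A) + of_bool (y \<in> A \<longleftrightarrow> d \<notin> A) + of_bool (x \<in> A \<longleftrightarrow> y \<notin> A)"
proof -
  define P where "P e \<longleftrightarrow> e \<inter> A \<noteq> {} \<and> e - A \<noteq> {}" for e
  define E0 where "E0 = edges H - {{a, b}, {c, d}}"
  have P2: "P {u, v} \<longleftrightarrow> (u \<in> A \<longleftrightarrow> v \<notin> A)" for u v by (auto simp: P_def)
  have fin: "finite E0" using finite_edges[OF simple_H] by (simp add: E0_def)
  define f where "f F = card {e \<in> F. P e}" for F
  have count: "f (insert z F) = f F + of_bool (P z)" if "finite F" "z \<notin> F" for z F
  proof -
    have "{e \<in> insert z F. P e} = (if P z then insert z {e \<in> F. P e} else {e \<in> F. P e})" by auto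
    then show ?thesis using that by (simp add: f_def)
  qed
  have EH: "edges H = insert {c, d} (insert {a, b} E0)"
    using path_edges by (auto simp: E0_def)
  have EG: "edges G = insert {x, y} (insert {y, d} (insert {c, y} (insert {x, b} (insert {a, x} E0))))"
    by (auto simp: edges_G E0_def)
  have notin: "{x, v} \<notin> E0" "{y, v} \<notin> E0" "{v, x} \<notin> E0" "{v, y} \<notin> E0" "{a, b} \<notin> E0" "{c, d} \<notin> E0" for v
    using edge_H_not_new by (auto simp: E0_def)
  have "edge_cut H (A \<inter> verts H) = {e \<in> edges H. P e}"
    using simple_H by (auto simp: edge_cut_def P_def simple_graph_def)
  then have "card (edge_cut H (A \<inter> verts H)) = f (edges H)" by (simp add: f_def)
  then have 1: "card (edge_cut H (A \<inter> verts H)) = f E0 + of_bool (P {a, b}) + of_bool (P {c, d})"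
    unfolding EH using notin fin distinct_verts by (simp add: count doubleton_eq_iff)
  have "card (edge_cut G A) = f (edges G)"
    by (simp add: edge_cut_def P_def f_def)
  then have 2: "card (edge_cut G A) = f E0 + of_bool (P {a, x}) + of_bool (P {x, b}) +
      of_bool (P {c, y}) + of_bool (P {y, d}) + of_bool (P {x, y})"
    unfolding EG using notin fin distinct_verts by (simp add: count doubleton_eq_iff)
  show ?thesis unfolding 1 2 P2 by simp
qed

lemma reduced_xy: "reduced G x y = H"
proof (rule graph_eqI)
  show "verts (reduced G x y) = verts H" using new by (auto simp: reduced_def verts_G)
  have "{e \<in> edges G. x \<notin> e \<and> y \<notin> e} = edges H - {{a, b}, {c, d}}"
    by (auto simp: edges_G dest: edge_H_not_new)
  moreover have "neighbours G x - {y} = {a, b}" "neighbours G y - {x} = {c, d}"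
    using distinct_verts by (auto simp: neighbours_x neighbours_y)
  ultimately show "edges (reduced G x y) = edges H"
    using path_edges by (auto simp: reduced_def)
qed

lemma reductions_G: "reductions G {{x, y}, {b, c}} = {H, reduced G b c}"
proof -
  have *: "suppress (suppress (delete_edges G {{u, v}}) u) v \<in> {H, reduced G b c}"
    if "{u, v} \<in> {{x, y}, {b, c}}" for u v
  proof -
    have "u \<noteq> v" using that distinct_verts by (auto simp: doubleton_eq_iff)
    then show ?thesis using that reduced_xy
      by (auto simp: suppress_suppress doubleton_eq_iff reduced_commute[of G y x] reduced_commute[of G c b])
  qed
  have "H \<in> reductions G {{x, y}, {b, c}}"
    unfolding reductions_def using suppress_suppress[OF new(3), of G] reduced_xy
    by (intro CollectI exI[of _ x] exI[of _ y]) simp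
  moreover have "reduced G b c \<in> reductions G {{x, y}, {b, c}}"
    unfolding reductions_def using suppress_suppress[OF path_distinct(4), of G]
    by (intro CollectI exI[of _ b] exI[of _ c]) simp
  moreover have "reductions G {{x, y}, {b, c}} \<subseteq> {H, reduced G b c}"
    unfolding reductions_def using * by auto
  ultimately show ?thesis by auto
qed

lemma edge_pair_G: "edge_pair G {{x, y}, {b, c}}"
  unfolding edge_pair_def
proof (intro exI conjI)
  show "is_cycle G [x, y, c, b]"
    using distinct_verts path_edges
    by (auto simp: is_cycle4 edge_G_iff doubleton_eq_iff insert_commute)
qed (auto simp: insert_commute)

end

locale doubling = subdivided_path +
  assumes cubic_H: "cubic H"
    and tf_H: "triangle_free H"
begin

lemma cubic_G: "cubic G"
  using cubic_H by (simp add: cubic_iff)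

text \<open>A triangle absent from \<open>H\<close> would pass through \<open>x\<close> or
  \<open>y\<close>. The neighbours \<open>a\<close>, \<open>b\<close>, \<open>y\<close> of
  \<open>x\<close> are pairwise non-adjacent since the edge between \<open>a\<close> and
  \<open>b\<close> has been subdivided, and \<open>y\<close> is symmetric.\<close>

lemma triangle_free_G: "triangle_free G"
  unfolding triangle_free_iff
proof (intro allI notI, elim conjE)
  fix u v w assume e: "{u, v} \<in> edges G" "{v, w} \<in> edges G" "{u, w} \<in> edges G"
  have no_x: False if "{x, p} \<in> edges G" "{x, q} \<in> edges G" "{p, q} \<in> edges G" for p q
  proof -
    have "p \<noteq> q" using edge_verts[OF simple_G that(3)] by simp
    moreover have "p \<in> {a, b, y}" "q \<in> {a, b, y}"
      using that(1,2) unfolding neighbours_x[symmetric] by simp_all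
    moreover have "{a, b} \<notin> edges G" "{a, y} \<notin> edges G" "{b, y} \<notin> edges G"
      using distinct_verts edge_H_not_new by (auto simp: edge_G_iff doubleton_eq_iff)
    ultimately show False using that(3) by (auto simp: insert_commute)
  qed
  have no_y: False if "{y, p} \<in> edges G" "{y, q} \<in> edges G" "{p, q} \<in> edges G" for p q
  proof -
    have "p \<noteq> q" using edge_verts[OF simple_G that(3)] by simp
    moreover have "p \<in> {c, d, x}" "q \<in> {c, d, x}"
      using that(1,2) unfolding neighbours_y[symmetric] by simp_all
    moreover have "{c, d} \<notin> edges G" "{c, x} \<notin> edges G" "{d, x} \<notin> edges G"
      using distinct_verts edge_H_not_new by (auto simp: edge_G_iff doubleton_eq_iff)
    ultimately show False using that(3) by (auto simp: insert_commute)
  qed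
  have old: "{p, q} \<in> edges H" if "{p, q} \<in> edges G" "p \<noteq> x" "p \<noteq> y" "q \<noteq> x" "q \<noteq> y" for p q
    using that by (auto simp: edge_G_iff doubleton_eq_iff)
  show False
  proof (cases "x \<in> {u, v, w} \<or> y \<in> {u, v, w}")
    case True
    then show False
      using e no_x[of v w] no_x[of u w] no_x[of u v] no_y[of v w] no_y[of u w] no_y[of u v]
      by (auto simp: insert_commute)
  next
    case False
    then have "{u, v} \<in> edges H" "{v, w} \<in> edges H" "{u, w} \<in> edges H"
      using e by (auto intro!: old)
    then show False using tf_H unfolding triangle_free_iff by metis
  qed
qed

lemma girth_G: "girth G = 4"
proof (rule girth_eq4I[OF simple_G triangle_free_G])
  show "is_cycle G [x, b, c, y]"
    using distinct_verts path_edges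
    by (auto simp: is_cycle4 edge_G_iff doubleton_eq_iff insert_commute)
qed

text \<open>Subdividing and adding an edge never shrinks a cut, which settles sets whose traces on
  \<open>H\<close> are large on both sides. Otherwise one side has at most one old vertex, hence at
  most three vertices, and \<open>card_cut_small\<close> applies.\<close>

lemma tight_G:
  assumes "tight H"
  shows "tight G"
  unfolding tight_def
proof (intro allI impI, elim conjE)
  fix A assume A: "A \<subseteq> verts G" "2 \<le> card A" "2 \<le> card (verts G - A)"
  have small: "card X \<le> 3" if "X \<subseteq> verts G" "card (X \<inter> verts H) \<le> 1" for X
  proof -
    have "X \<subseteq> (X \<inter> verts H) \<union> {x, y}" using that verts_G by auto
    moreover have fX: "finite (X \<inter> verts H)" using finite_verts[OF simple_H] by simp
    ultimately have "card X \<le> card ((X \<inter> verts H) \<union> {x, y})" by (intro card_mono) auto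
    also have "\<dots> \<le> card (X \<inter> verts H) + card {x, y}" by (rule card_Un_le)
    finally show ?thesis using that card_2_iff[of "{x, y}"] new by simp
  qed
  have small_cut: "4 \<le> card (edge_cut G X)"
    if "X \<subseteq> verts G" "2 \<le> card X" "card (X \<inter> verts H) \<le> 1" for X
    using card_cut_small[OF cubic_G triangle_free_G that(1,2) small[OF that(1,3)]] .
  have eq: "(verts G - A) \<inter> verts H = verts H - A \<inter> verts H" using verts_G by auto
  show "4 \<le> card (edge_cut G A)"
  proof (cases "2 \<le> card (A \<inter> verts H) \<and> 2 \<le> card (verts H - A \<inter> verts H)")
    case True
    then have "4 \<le> card (edge_cut H (A \<inter> verts H))"
      using assms unfolding tight_def by simp
    then show ?thesis using cut_G[of A]
      by (cases "a \<in> A"; cases "b \<in> A"; cases "c \<in> A"; cases "d \<in> A"; cases "x \<in> A"; cases "y \<in> A"; simp)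
  next
    case False
    then show ?thesis
      using small_cut[OF A(1,2)] small_cut[of "verts G - A"] A(3) cut_compl[OF simple_G] eq
      by auto
  qed
qed

text \<open>Once \<open>b\<close> and \<open>c\<close> are suppressed, \<open>x\<close> is adjacent
  to \<open>a\<close>, \<open>y\<close>, \<open>b0\<close> and \<open>y\<close> to \<open>d\<close>,
  \<open>x\<close>, \<open>c0\<close>. So \<open>x\<close> and \<open>y\<close> have taken over the
  roles of \<open>b\<close> and \<open>c\<close> in \<open>H\<close>, and the isomorphism fixes
  everything else.\<close>

lemma reduced_bc_iso: "isomorphic H (reduced G b c)"
proof -
  obtain b0 where b0: "neighbours H b = {a, c, b0}" "b0 \<noteq> a" "b0 \<noteq> c"
    using card3_obtain[OF cubic_card_neighbours[OF cubic_H path_verts(2)], of a c]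
      path_edges path_distinct by (auto simp: insert_commute)
  obtain c0 where c0: "neighbours H c = {b, d, c0}" "c0 \<noteq> b" "c0 \<noteq> d"
    using card3_obtain[OF cubic_card_neighbours[OF cubic_H path_verts(3)], of b d]
      path_edges path_distinct by (auto simp: insert_commute)
  have b0b: "b0 \<noteq> b" "b0 \<noteq> x" "b0 \<noteq> y" and c0c: "c0 \<noteq> c" "c0 \<noteq> x" "c0 \<noteq> y"
    using not_self_neighbour[OF simple_H, of b] not_self_neighbour[OF simple_H, of c] b0 c0
      neighbours_subset[OF simple_H, of b] neighbours_subset[OF simple_H, of c] new by auto
  have bE: "{b, w} \<in> edges H \<longleftrightarrow> w \<in> {a, c, b0}" and cE: "{c, w} \<in> edges H \<longleftrightarrow> w \<in> {b, d, c0}" for w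
    by (simp_all flip: mem_neighbours add: b0(1) c0(1))
  define s where "s v = (if v = b then x else if v = c then y else v)" for v
  define E1 where "E1 = {e \<in> edges H. b \<notin> e \<and> c \<notin> e}"
  have EH: "edges H = E1 \<union> {{b, a}, {b, c}, {b, b0}, {c, d}, {c, c0}}"
  proof (intro set_eqI iffI)
    fix e assume e: "e \<in> edges H"
    then obtain u v where uv: "e = {u, v}" using edge_ex[OF simple_H] by metis
    have "w \<in> {a, c, b0}" if "e = {b, w}" for w using that e bE by simp
    moreover have "w \<in> {b, d, c0}" if "e = {c, w}" for w using that e cE by simp
    moreover have "e \<in> E1 \<or> (\<exists>w. e = {b, w}) \<or> (\<exists>w. e = {c, w})"
      using e uv by (auto simp: E1_def)
    ultimately show "e \<in> E1 \<union> {{b, a}, {b, c}, {b, b0}, {c, d}, {c, c0}}"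
      by (auto simp: insert_commute)
  next
    fix e assume "e \<in> E1 \<union> {{b, a}, {b, c}, {b, b0}, {c, d}, {c, c0}}"
    moreover have "{b, a} \<in> edges H" "{b, b0} \<in> edges H" "{c, c0} \<in> edges H" "{c, d} \<in> edges H"
      by (simp_all add: bE cE)
    ultimately show "e \<in> edges H" using path_edges by (auto simp: E1_def)
  qed
  have "{e \<in> edges G. b \<notin> e \<and> c \<notin> e} = E1 \<union> {{a, x}, {y, d}, {x, y}}"
    using distinct_verts by (auto simp: edges_G E1_def)
  moreover have "neighbours G b - {c} = {x, b0}" "neighbours G c - {b} = {y, c0}"
    using distinct_verts b0 b0b c0 c0c
    by (auto simp: neighbours_old path_verts simp del: mem_neighbours)
  ultimately have ER: "edges (reduced G b c) = E1 \<union> {{x, a}, {x, y}, {x, b0}, {y, d}, {y, c0}}"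
    by (auto simp: reduced_def insert_commute)
  have sE1: "(\<lambda>e. s ` e) ` E1 = E1"
  proof -
    have "s ` e = e" if "e \<in> E1" for e
    proof -
      have "s v = v" if "v \<in> e" for v using that \<open>e \<in> E1\<close> by (auto simp: s_def E1_def)
      then show ?thesis by simp
    qed
    then show ?thesis by simp
  qed
  have sv: "s b = x" "s c = y" "s a = a" "s d = d" "s b0 = b0" "s c0 = c0"
    using distinct_verts b0 b0b c0 c0c by (auto simp: s_def)
  have "edges (reduced G b c) = (\<lambda>e. s ` e) ` edges H"
    unfolding ER EH image_Un sE1 by (simp add: sv)
  moreover have "bij_betw s (verts H) (verts (reduced G b c))"
  proof (rule bij_betw_imageI)
    show "inj_on s (verts H)" using new by (auto simp: inj_on_def s_def)
    have "s ` verts H = {x, y} \<union> s ` (verts H - {b, c})"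
      using path_verts sv by (auto simp: s_def)
    also have "s ` (verts H - {b, c}) = verts H - {b, c}" by (auto simp: s_def)
    finally show "s ` verts H = verts (reduced G b c)"
      using path_verts distinct_verts by (auto simp: reduced_def verts_G)
  qed
  ultimately show ?thesis by (auto simp: isomorphic_def graph_iso_def)
qed

end

section \<open>Isomorphisms\<close>

lemma graph_iso_edges: "graph_iso f G G' \<Longrightarrow> edges G' = (\<lambda>e. f ` e) ` edges G"
  by (simp add: graph_iso_def)

lemma graph_iso_inj: "graph_iso f G G' \<Longrightarrow> inj_on f (verts G)"
  by (simp add: graph_iso_def bij_betw_def)

lemma graph_iso_verts: "graph_iso f G G' \<Longrightarrow> verts G' = f ` verts G"
  by (simp add: graph_iso_def bij_betw_def)

lemma simple_edge_subset: "simple_graph G \<Longrightarrow> e \<in> edges G \<Longrightarrow> e \<subseteq> verts G"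
  by (simp add: simple_graph_def)

lemma graph_iso_id: "graph_iso id G G"
  by (simp add: graph_iso_def)

lemma graph_iso_comp:
  assumes "graph_iso f G G'" "graph_iso g G' G''"
  shows "graph_iso (g \<circ> f) G G''"
  using assms bij_betw_trans[of f "verts G" "verts G'" g "verts G''"]
  by (auto simp: graph_iso_def image_image image_comp)

lemma graph_iso_inv:
  assumes "simple_graph G" "graph_iso f G G'"
  shows "graph_iso (inv_into (verts G) f) G' G"
proof -
  have "inv_into (verts G) f ` f ` e = e" if "e \<in> edges G" for e
    using inv_into_image_cancel[OF graph_iso_inj[OF assms(2)] simple_edge_subset[OF assms(1) that]] .
  then have "(\<lambda>e. inv_into (verts G) f ` e) ` edges G' = edges G"
    by (simp add: graph_iso_edges[OF assms(2)] image_image)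
  then show ?thesis using assms bij_betw_inv_into by (auto simp: graph_iso_def)
qed

lemma simple_graph_iso:
  assumes "simple_graph G" "graph_iso f G G'"
  shows "simple_graph G'"
proof -
  have "f ` e \<subseteq> f ` verts G \<and> card (f ` e) = 2" if "e \<in> edges G" for e
  proof -
    have "e \<subseteq> verts G" "card e = 2" using assms(1) that by (auto simp: simple_graph_def)
    then show ?thesis
      using card_image[OF inj_on_subset[OF graph_iso_inj[OF assms(2)]]] by auto
  qed
  then show ?thesis
    using finite_verts[OF assms(1)]
    by (simp add: simple_graph_def graph_iso_edges[OF assms(2)] graph_iso_verts[OF assms(2)])
qed

lemma isomorphic_sym: "simple_graph G \<Longrightarrow> isomorphic G H \<Longrightarrow> isomorphic H G"
  unfolding isomorphic_def using graph_iso_inv by metis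

lemma isomorphic_trans: "isomorphic G H \<Longrightarrow> isomorphic H K \<Longrightarrow> isomorphic G K"
  unfolding isomorphic_def using graph_iso_comp by metis

lemma isomorphic_refl: "isomorphic G G"
  unfolding isomorphic_def using graph_iso_id by metis

lemma map_edges_comp: "map_edges (g \<circ> f) p = map_edges g (map_edges f p)"
  by (simp add: map_edges_def image_image image_comp)

lemma map_edges_id: "map_edges id p = p"
  by (simp add: map_edges_def)

lemma map_edges_inv:
  assumes "inj_on f V" "p \<subseteq> Pow V"
  shows "map_edges (inv_into V f) (map_edges f p) = p"
proof -
  have "inv_into V f ` f ` e = e" if "e \<in> p" for e
    using inv_into_image_cancel[OF assms(1)] assms(2) that by auto
  then show ?thesis by (simp add: map_edges_def image_image)
qed

lemma edge_iso_iff: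
  assumes "simple_graph G" "graph_iso f G G'" "u \<in> verts G" "v \<in> verts G"
  shows "{f u, f v} \<in> edges G' \<longleftrightarrow> {u, v} \<in> edges G"
proof
  assume "{f u, f v} \<in> edges G'"
  then obtain e where e: "e \<in> edges G" "f ` {u, v} = f ` e"
    using graph_iso_edges[OF assms(2)] by auto
  then have "{u, v} = e"
    using inj_on_image_eq_iff[OF graph_iso_inj[OF assms(2)], of "{u, v}" e]
      simple_edge_subset[OF assms(1) e(1)] assms by simp
  then show "{u, v} \<in> edges G" using e by simp
next
  assume "{u, v} \<in> edges G"
  then have "f ` {u, v} \<in> edges G'" unfolding graph_iso_edges[OF assms(2)] by (rule imageI)
  then show "{f u, f v} \<in> edges G'" by simp
qed

lemma neighbours_iso:
  assumes "simple_graph G" "graph_iso f G G'" "v \<in> verts G"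
  shows "neighbours G' (f v) = f ` neighbours G v"
proof
  show "neighbours G' (f v) \<subseteq> f ` neighbours G v"
  proof
    fix w assume w: "w \<in> neighbours G' (f v)"
    then have "w \<in> f ` verts G"
      using edge_verts(2)[OF simple_graph_iso[OF assms(1,2)]] graph_iso_verts[OF assms(2)] by auto
    then obtain u where "u \<in> verts G" "w = f u" by auto
    then show "w \<in> f ` neighbours G v" using w edge_iso_iff[OF assms(1,2,3)] by auto
  qed
  show "f ` neighbours G v \<subseteq> neighbours G' (f v)"
    using edge_iso_iff[OF assms(1,2,3)] neighbours_subset[OF assms(1), of v] by auto
qed

text \<open>A reduction is defined through neighbourhoods alone, so the same map works; injectivity
  on the vertices lets it commute with the removal of \<open>x\<close> and \<open>y\<close>.\<close>

lemma reduced_iso: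
  assumes G: "simple_graph G" and f: "graph_iso f G G'" and xy: "x \<in> verts G" "y \<in> verts G"
  shows "graph_iso f (reduced G x y) (reduced G' (f x) (f y))"
proof -
  have inj: "inj_on f (verts G)" using f by (rule graph_iso_inj)
  have mem: "f z \<in> f ` e \<longleftrightarrow> z \<in> e" if "e \<in> edges G" "z \<in> verts G" for z e
    using inj_on_image_mem_iff[OF inj that(2) simple_edge_subset[OF G that(1)]] .
  have N: "neighbours G' (f z) - {f w} = f ` (neighbours G z - {w})"
    if "z \<in> verts G" "w \<in> verts G" for z w
  proof -
    have "neighbours G z - {w} \<subseteq> verts G" "{w} \<subseteq> verts G"
      using neighbours_subset[OF G, of z] that by auto
    from inj_on_image_set_diff[OF inj this] show ?thesis
      using that by (simp add: neighbours_iso[OF G f])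
  qed
  have "{e \<in> edges G'. f x \<notin> e \<and> f y \<notin> e} = (\<lambda>e. f ` e) ` {e \<in> edges G. x \<notin> e \<and> y \<notin> e}"
    using mem xy unfolding graph_iso_edges[OF f] by auto
  then have "edges (reduced G' (f x) (f y)) = (\<lambda>e. f ` e) ` edges (reduced G x y)"
    using xy by (simp add: reduced_def N image_Un)
  moreover have "bij_betw f (verts G - {x, y}) (verts G' - {f x, f y})"
    unfolding graph_iso_verts[OF f]
    using inj_on_image_set_diff[OF inj, of "verts G" "{x, y}"] xy inj
    by (auto simp: bij_betw_def intro: inj_on_subset)
  ultimately show ?thesis by (simp add: graph_iso_def reduced_def)
qed

lemma class1_iso:
  assumes G: "simple_graph G" and f: "graph_iso f G G'" and "class1 G'"
  shows "class1 G"
proof -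
  obtain col :: "'b set \<Rightarrow> nat" where col: "\<And>e. e \<in> edges G' \<Longrightarrow> col e < 3"
    "\<And>e e'. e \<in> edges G' \<Longrightarrow> e' \<in> edges G' \<Longrightarrow> e \<noteq> e' \<Longrightarrow> e \<inter> e' \<noteq> {} \<Longrightarrow> col e \<noteq> col e'"
    using assms(3) unfolding class1_def by metis
  have im: "f ` e \<in> edges G'" if "e \<in> edges G" for e
    using that graph_iso_edges[OF f] by simp
  show ?thesis unfolding class1_def
  proof (intro exI[of _ "\<lambda>e. col (f ` e)"] conjI ballI impI)
    fix e e' assume e: "e \<in> edges G" "e' \<in> edges G" "e \<noteq> e' \<and> e \<inter> e' \<noteq> {}"
    have "f ` e \<noteq> f ` e'"
      using inj_on_image_eq_iff[OF graph_iso_inj[OF f]] simple_edge_subset[OF G] e by metis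
    moreover have "f ` e \<inter> f ` e' \<noteq> {}" using e(3) by auto
    ultimately show "col (f ` e) \<noteq> col (f ` e')" using col(2)[OF im im] e by simp
  qed (use col(1) im in auto)
qed

text \<open>The middle edge is the only one that meets both others, so it is recognisable in the
  edge set and leaves only the direction open.\<close>

lemma path4_edge_set_unique:
  assumes d: "distinct [a, b, c, d]" and d': "distinct [a', b', c', d']"
    and eq: "{{a, b}, {b, c}, {c, d}} = {{a', b'}, {b', c'}, {c', d'}}"
  shows "(a', b', c', d') = (a, b, c, d) \<or> (a', b', c', d') = (d, c, b, a)"
proof -
  let ?P = "{{a, b}, {b, c}, {c, d}}"
  have meet: "{b', c'} \<inter> e \<noteq> {}" if "e \<in> ?P" for e using that unfolding eq by auto
  have in_P: "{a', b'} \<in> ?P" "{b', c'} \<in> ?P" "{c', d'} \<in> ?P" unfolding eq by simp_all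
  have "{b', c'} \<noteq> {a, b}" using meet[of "{c, d}"] d by auto
  moreover have "{b', c'} \<noteq> {c, d}" using meet[of "{a, b}"] d by auto
  ultimately have "{b', c'} = {b, c}" using in_P by simp
  then have "b' = b \<and> c' = c \<or> b' = c \<and> c' = b" by (simp add: doubleton_eq_iff)
  then show ?thesis
    using in_P(1,3) d d' by (auto simp: doubleton_eq_iff)
qed

context subdivided_path
begin

lemma reversed: "subdivided_path H d c b a y x G"
proof
  show "path4 H d c b a" using path by (auto simp: path4_def insert_commute)
  show "G = Graph (verts H \<union> {y, x}) (edges H - {{d, c}, {b, a}} \<union>
      {{d, y}, {y, c}, {b, x}, {x, a}, {y, x}})"
    unfolding G_eq by (simp add: insert_commute)
qed (use new simple_H in auto)

lemma extend_iso:
  assumes f: "graph_iso f H H'" and "subdivided_path H' (f a) (f b) (f c) (f d) x' y' G'"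
  obtains g where "graph_iso g G G'" "map_edges g {{x, y}, {b, c}} = {{x', y'}, {f b, f c}}"
proof -
  interpret D: subdivided_path H' "f a" "f b" "f c" "f d" x' y' G' by fact
  define g where "g = f(x := x', y := y')"
  have gv: "g v = f v" if "v \<noteq> x" "v \<noteq> y" for v using that by (simp add: g_def)
  have gx: "g x = x'" "g y = y'" using new by (simp_all add: g_def)
  have gH: "g ` e = f ` e" if "x \<notin> e" "y \<notin> e" for e
    using that gv by (intro image_cong refl) metis
  have g4: "g a = f a" "g b = f b" "g c = f c" "g d = f d"
    using new_distinct by (auto intro!: gv)
  have "graph_iso g G G'" unfolding graph_iso_def
  proof
    have "g ` verts G = insert x' (insert y' (g ` verts H))"
      by (simp add: verts_G gx)
    also have "g ` verts H = verts H'"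
      using gH new graph_iso_verts[OF f] by simp
    finally have "g ` verts G = verts G'" by (simp add: D.verts_G)
    moreover have "inj_on g (verts G)"
    proof -
      have "inj_on g (verts H)"
        using inj_on_cong[of "verts H" g f] gv new graph_iso_inj[OF f] by metis
      then show ?thesis
        using D.new gH[of "verts H"] new graph_iso_verts[OF f] unfolding verts_G
        by (auto simp: inj_on_Un gx)
    qed
    ultimately show "bij_betw g (verts G) (verts G')" by (simp add: bij_betw_def)
    have inj: "inj_on (\<lambda>e. f ` e) (edges H)"
      using inj_on_image_eq_iff[OF graph_iso_inj[OF f]] simple_edge_subset[OF simple_H]
      unfolding inj_on_def by metis
    have "(\<lambda>e. g ` e) ` (edges H - {{a, b}, {c, d}}) = (\<lambda>e. f ` e) ` (edges H - {{a, b}, {c, d}})"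
    proof (rule image_cong[OF refl])
      fix e assume "e \<in> edges H - {{a, b}, {c, d}}"
      then show "g ` e = f ` e" using gH edge_H_not_new by simp
    qed
    also have "\<dots> = edges H' - {{f a, f b}, {f c, f d}}"
      using inj_on_image_set_diff[OF inj, of "edges H" "{{a, b}, {c, d}}"] path_edges
        graph_iso_edges[OF f] by simp
    finally show "edges G' = (\<lambda>e. g ` e) ` edges G"
      unfolding edges_G D.edges_G image_Un by (simp add: gx g4)
  qed
  moreover have "map_edges g {{x, y}, {b, c}} = {{x', y'}, {f b, f c}}"
    by (simp add: map_edges_def gx g4)
  ultimately show thesis using that by metis
qed

text \<open>An operation records only the edge set of its path, so \<open>f\<close> may reverse the
  direction. Then the new vertices are matched crosswise, which leaves the edge pair unchanged as a
  set.\<close>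

lemma extend_iso_path:
  assumes f: "graph_iso f H H'" and D: "subdivided_path H' a' b' c' d' x' y' G'"
    and P: "map_edges f {{a, b}, {b, c}, {c, d}} = {{a', b'}, {b', c'}, {c', d'}}"
  obtains g where "graph_iso g G G'" "map_edges g {{x, y}, {b, c}} = {{x', y'}, {b', c'}}"
proof -
  interpret D: subdivided_path H' a' b' c' d' x' y' G' by fact
  have "distinct [f a, f b, f c, f d]"
    using path_distinct path_verts graph_iso_inj[OF f] by (auto simp: inj_on_eq_iff)
  moreover have "distinct [a', b', c', d']" using D.path_distinct by auto
  moreover have "{{f a, f b}, {f b, f c}, {f c, f d}} = {{a', b'}, {b', c'}, {c', d'}}"
    using P by (simp add: map_edges_def)
  ultimately have "(a', b', c', d') = (f a, f b, f c, f d) \<or> (a', b', c', d') = (f d, f c, f b, f a)"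
    by (rule path4_edge_set_unique)
  then show thesis
  proof
    assume eq: "(a', b', c', d') = (f a, f b, f c, f d)"
    then have "subdivided_path H' (f a) (f b) (f c) (f d) x' y' G'" using D by simp
    from extend_iso[OF f this] that eq show thesis by auto
  next
    assume eq: "(a', b', c', d') = (f d, f c, f b, f a)"
    then have "subdivided_path H' (f a) (f b) (f c) (f d) y' x' G'" using D.reversed by simp
    from extend_iso[OF f this] obtain g where
      "graph_iso g G G'" "map_edges g {{x, y}, {b, c}} = {{y', x'}, {f b, f c}}" by metis
    then show thesis using that[of g] eq by (simp add: insert_commute)
  qed
qed

lemma edge_doubling: "edge_doubling (H, {{a, b}, {b, c}, {c, d}}) G {{x, y}, {b, c}}"
  unfolding edge_doubling_def
  by (rule exI[of _ H], rule exI[of _ a], rule exI[of _ b], rule exI[of _ c], rule exI[of _ d],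
      rule exI[of _ x], rule exI[of _ y]) (use path new G_eq in simp)

end

lemma doubling_from_operation:
  assumes "C \<in> operations H" "edge_doubling C G p"
  obtains a b c d x y where "doubling H a b c d x y G" "p = {{x, y}, {b, c}}"
    "C = (H, {{a, b}, {b, c}, {c, d}})"
proof -
  have H: "fst C = H" "cubic H" "4 \<le> girth H"
    using assms(1) unfolding operations_def by (elim CollectE exE conjE, simp)+
  from assms(2) obtain H' a b c d x y where *: "C = (H', {{a, b}, {b, c}, {c, d}})" "path4 H' a b c d"
     "x \<notin> verts H'" "y \<notin> verts H'" "x \<noteq> y"
     "G = Graph (verts H' \<union> {x, y})
               (edges H' - {{a, b}, {c, d}} \<union> {{a, x}, {x, b}, {c, y}, {y, d}, {x, y}})"
     "p = {{x, y}, {b, c}}"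
    unfolding edge_doubling_def by (elim exE conjE)
  have H': "H' = H" using H(1) *(1) by simp
  have "doubling H a b c d x y G"
    using *(2-6) H(2,3) triangle_free_iff_girth[OF cubic_simple[OF H(2)]] cubic_simple[OF H(2)]
    unfolding H' by (intro doubling.intro subdivided_path.intro doubling_axioms.intro) simp_all
  then show thesis using that *(1,7) unfolding H' by metis
qed

text \<open>An isomorphism of the results carries one reduction to the other, up to the exchange of the two edges of a pair.\<close>

lemma doubling_iso_reflects:
  assumes D: "doubling H a b c d x y G" and D': "doubling H' a' b' c' d' x' y' G'"
    and g: "graph_iso g G G'" and p: "map_edges g {{x, y}, {b, c}} = {{x', y'}, {b', c'}}"
  shows "isomorphic H H'"
proof -
  interpret D: doubling H a b c d x y G by fact
  interpret D': doubling H' a' b' c' d' x' y' G' by fact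
  have "isomorphic H (reduced G' (g x) (g y))"
    using reduced_iso[OF D.simple_G g, of x y] D.verts_G D.reduced_xy by (auto simp: isomorphic_def)
  moreover have "reduced G' (g x) (g y) \<in> {H', reduced G' b' c'}"
  proof -
    have "g ` {x, y} \<in> map_edges g {{x, y}, {b, c}}" by (simp add: map_edges_def)
    then have "{g x, g y} \<in> {{x', y'}, {b', c'}}" unfolding p by simp
    then show ?thesis
      using D'.reduced_xy reduced_commute[of G' y' x'] reduced_commute[of G' c' b']
      by (auto simp: doubleton_eq_iff)
  qed
  moreover have "isomorphic (reduced G' b' c') H'"
    using isomorphic_sym[OF D'.simple_H D'.reduced_bc_iso] .
  ultimately show ?thesis using isomorphic_trans by auto
qed

section \<open>Extending 3-edge-colourings\<close>

lemma class1I: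
  fixes col :: "'a set \<Rightarrow> nat"
  assumes G: "simple_graph G" and col: "\<And>e. e \<in> edges G \<Longrightarrow> col e < 3"
    and proper: "\<And>w p q. {w, p} \<in> edges G \<Longrightarrow> {w, q} \<in> edges G \<Longrightarrow> p \<noteq> q \<Longrightarrow> col {w, p} \<noteq> col {w, q}"
  shows "class1 G"
  unfolding class1_def
proof (intro exI[of _ col] conjI ballI impI)
  fix e f assume e: "e \<in> edges G" and f: "f \<in> edges G" and ne: "e \<noteq> f \<and> e \<inter> f \<noteq> {}"
  then obtain w where w: "w \<in> e" "w \<in> f" by auto
  obtain p where p: "e = {w, p}" using edge_ex[OF G e] w(1) by auto
  obtain q where q: "f = {w, q}" using edge_ex[OF G f] w(2) by auto
  show "col e \<noteq> col f" using proper e f ne unfolding p q by auto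
qed (use col in auto)

text \<open>Here \<open>K\<close> is the path that starts at \<open>v\<close>; it is found by deleting \<open>v\<close> and continuing from its
  neighbour.\<close>

lemma kempe_chain:
  assumes "finite V"
    and "\<And>w. w \<in> V \<Longrightarrow> adj w \<subseteq> V - {w}"
    and "\<And>u w. w \<in> V \<Longrightarrow> u \<in> adj w \<Longrightarrow> w \<in> adj u"
    and "\<And>w. w \<in> V \<Longrightarrow> card (adj w) \<le> 2"
    and "v \<in> V" "card (adj v) = 1"
  shows "\<exists>K z. K \<subseteq> V \<and> v \<in> K \<and> (\<forall>w\<in>K. adj w \<subseteq> K) \<and> z \<in> K \<and> z \<noteq> v \<and>
    (\<forall>w\<in>K. card (adj w) = 1 \<longleftrightarrow> w = v \<or> w = z)"
  using assms
proof (induction "card V" arbitrary: V adj v rule: less_induct)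
  case less
  note sub = less.prems(2) and symm = less.prems(3) and deg = less.prems(4)
  obtain z where z: "adj v = {z}" using less.prems(6) by (auto simp: card_1_singleton_iff)
  have zV: "z \<in> V" "z \<noteq> v" using sub[OF less.prems(5)] z by auto
  have vz: "v \<in> adj z" using symm[OF less.prems(5)] z by auto
  have fz: "finite (adj z)" using sub[OF zV(1)] less.prems(1) by (meson finite_Diff finite_subset)
  show ?case
  proof (cases "card (adj z) = 1")
    case True
    then have "adj z = {v}" using vz by (auto simp: card_1_singleton_iff)
    then show ?thesis using z zV less.prems(5) by (intro exI[of _ "{v, z}"] exI[of _ z]) auto
  next
    case False
    have "card (adj z) \<noteq> 0" using vz fz by auto
    then have two: "card (adj z) = 2" using False deg[OF zV(1)] by linarith
    define V' where "V' = V - {v}"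
    define adj' where "adj' w = adj w - {v}" for w
    have v_adj: "v \<in> adj w \<longleftrightarrow> w = z" if "w \<in> V" for w
      using symm[OF that] z vz by auto
    then have adj'_eq: "adj' w = adj w" if "w \<in> V'" "w \<noteq> z" for w
      using that by (auto simp: adj'_def V'_def)
    have one: "card (adj' z) = 1" using two vz fz by (simp add: adj'_def)
    have "\<exists>K t. K \<subseteq> V' \<and> z \<in> K \<and> (\<forall>w\<in>K. adj' w \<subseteq> K) \<and> t \<in> K \<and> t \<noteq> z \<and>
      (\<forall>w\<in>K. card (adj' w) = 1 \<longleftrightarrow> w = z \<or> w = t)"
    proof (rule less.hyps)
      show "card V' < card V" using card_Diff1_less[OF less.prems(1,5)] by (simp only: V'_def)
      show "finite V'" using less.prems(1) by (simp add: V'_def)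
      show "adj' w \<subseteq> V' - {w}" if "w \<in> V'" for w
        using that sub by (auto simp: V'_def adj'_def)
      show "w \<in> adj' u" if "w \<in> V'" "u \<in> adj' w" for u w
        using that symm by (auto simp: V'_def adj'_def)
      show "card (adj' w) \<le> 2" if "w \<in> V'" for w
        using that one deg adj'_eq by (cases "w = z") (auto simp: V'_def)
      show "z \<in> V'" using zV by (simp add: V'_def)
    qed (rule one)
    then obtain K t where K: "K \<subseteq> V'" "z \<in> K" "\<And>w. w \<in> K \<Longrightarrow> adj' w \<subseteq> K" "t \<in> K" "t \<noteq> z"
      "\<And>w. w \<in> K \<Longrightarrow> card (adj' w) = 1 \<longleftrightarrow> w = z \<or> w = t" by metis
    show ?thesis
    proof (intro exI[of _ "insert v K"] exI[of _ t] conjI ballI)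
      show "insert v K \<subseteq> V" "v \<in> insert v K" "t \<in> insert v K" "t \<noteq> v"
        using K(1,4) less.prems(5) by (auto simp: V'_def)
      fix w assume w: "w \<in> insert v K"
      show "adj w \<subseteq> insert v K"
        using w z K(2,3) by (auto simp: adj'_def)
      \<comment> \<open>With \<open>v\<close> restored, \<open>z\<close> has degree 2 and ceases to
        be an end of the path; \<open>v\<close> takes its place.\<close>
      show "card (adj w) = 1 \<longleftrightarrow> w = v \<or> w = t"
      proof -
        consider "w = v" | "w = z" | "w \<in> K" "w \<noteq> z" using w by auto
        then show ?thesis
        proof cases
          case 3
          then have "w \<in> V'" using K(1) by auto
          then show ?thesis using 3 K(6)[of w] adj'_eq[of w] by (auto simp: V'_def)
        qed (use z two zV K(5) in simp_all)
      qed
    qed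
  qed
qed

text \<open>The third neighbours of consecutive corners are distinct by triangle-freeness, whereas
  \<open>u1 = u3\<close> or \<open>u2 = u4\<close> may happen. \<open>rotate\<close> and
  \<open>reflect\<close> carry each statement about one corner to the others.\<close>

locale square =
  fixes G :: "'a ugraph" and v1 v2 v3 v4 u1 u2 u3 u4 :: 'a
  assumes cubic_G: "cubic G" and tf: "triangle_free G"
    and N1: "neighbours G v1 = {v2, v4, u1}" and N2: "neighbours G v2 = {v1, v3, u2}"
    and N3: "neighbours G v3 = {v2, v4, u3}" and N4: "neighbours G v4 = {v1, v3, u4}"
    and v_distinct: "distinct [v1, v2, v3, v4]"
begin

lemma simple_G: "simple_graph G"
  using cubic_G by (rule cubic_simple)

lemma rotate: "square G v2 v3 v4 v1 u2 u3 u4 u1"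
  using cubic_G tf N1 N2 N3 N4 v_distinct
  by unfold_locales (auto simp: insert_commute simp del: mem_neighbours)

lemma reflect: "square G v2 v1 v4 v3 u2 u1 u4 u3"
  using cubic_G tf N1 N2 N3 N4 v_distinct
  by unfold_locales (auto simp: insert_commute simp del: mem_neighbours)

lemma edge_v:
  "{v1, w} \<in> edges G \<longleftrightarrow> w \<in> {v2, v4, u1}" "{v2, w} \<in> edges G \<longleftrightarrow> w \<in> {v1, v3, u2}"
  "{v3, w} \<in> edges G \<longleftrightarrow> w \<in> {v2, v4, u3}" "{v4, w} \<in> edges G \<longleftrightarrow> w \<in> {v1, v3, u4}"
  unfolding N1[symmetric] N2[symmetric] N3[symmetric] N4[symmetric] by simp_all

lemma v_verts: "v1 \<in> verts G" "v2 \<in> verts G" "v3 \<in> verts G" "v4 \<in> verts G"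
  using edge_verts[OF simple_G, of v1 v2] edge_verts[OF simple_G, of v3 v4] by (simp_all add: edge_v)

lemma u_verts: "u1 \<in> verts G" "u2 \<in> verts G" "u3 \<in> verts G" "u4 \<in> verts G"
  using edge_verts(2)[OF simple_G, of v1 u1] edge_verts(2)[OF simple_G, of v2 u2]
    edge_verts(2)[OF simple_G, of v3 u3] edge_verts(2)[OF simple_G, of v4 u4]
  by (simp_all add: edge_v)

lemma u1_new: "u1 \<noteq> v1" "u1 \<noteq> v2" "u1 \<noteq> v3" "u1 \<noteq> v4" "u1 \<noteq> u2"
proof -
  have c: "card {v2, v4, u1} = 3" using cubic_card_neighbours[OF cubic_G v_verts(1)] N1 by simp
  show "u1 \<noteq> v2" using c by (intro notI) (simp add: card_insert_if split: if_splits)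
  show "u1 \<noteq> v4" using c by (intro notI) (simp add: card_insert_if split: if_splits)
  show "u1 \<noteq> v1" using edge_verts(3)[OF simple_G, of v1 u1] by (simp add: edge_v)
  have no: "\<not> ({v1, v2} \<in> edges G \<and> {v2, w} \<in> edges G \<and> {v1, w} \<in> edges G)" for w
    using tf unfolding triangle_free_iff by metis
  show "u1 \<noteq> v3" using no[of v3] unfolding edge_v by auto
  show "u1 \<noteq> u2" using no[of u2] unfolding edge_v by auto
qed

lemmas u2_new = square.u1_new[OF rotate]
lemmas u3_new = square.u1_new[OF square.rotate[OF rotate]]
lemmas u4_new = square.u1_new[OF square.rotate[OF square.rotate[OF rotate]]]

lemma v_neq: "v1 \<noteq> v2" "v1 \<noteq> v3" "v1 \<noteq> v4" "v2 \<noteq> v3" "v2 \<noteq> v4" "v3 \<noteq> v4"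
  using v_distinct by auto

lemmas neq = v_neq v_neq[symmetric] u1_new u2_new u3_new u4_new
  u1_new[symmetric] u2_new[symmetric] u3_new[symmetric] u4_new[symmetric]

definition outer :: "'a set set" where
  "outer = edges G - {{v1, v2}, {v2, v3}, {v3, v4}, {v4, v1}}"

text \<open>The 4-cycle itself is left uncoloured; whether such a colouring extends to it depends
  only on the colours of the four edges from \<open>v1\<close>, ..., \<open>v4\<close> to
  \<open>u1\<close>, ..., \<open>u4\<close>.\<close>

definition outer_colouring :: "('a set \<Rightarrow> nat) \<Rightarrow> bool" where
  "outer_colouring k \<longleftrightarrow> (\<forall>e\<in>outer. k e < 3) \<and>
    (\<forall>w p q. {w, p} \<in> outer \<longrightarrow> {w, q} \<in> outer \<longrightarrow> p \<noteq> q \<longrightarrow> k {w, p} \<noteq> k {w, q})"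

lemma outer_v:
  "{v1, w} \<in> outer \<longleftrightarrow> w = u1" "{v2, w} \<in> outer \<longleftrightarrow> w = u2"
  "{v3, w} \<in> outer \<longleftrightarrow> w = u3" "{v4, w} \<in> outer \<longleftrightarrow> w = u4"
  using neq by (auto simp: outer_def edge_v doubleton_eq_iff)

lemma outer_other:
  assumes "w \<notin> {v1, v2, v3, v4}"
  shows "{w, p} \<in> outer \<longleftrightarrow> {w, p} \<in> edges G"
  using assms by (auto simp: outer_def doubleton_eq_iff)

lemma outer_edge: "e \<in> outer \<Longrightarrow> e \<in> edges G"
  by (simp add: outer_def)

text \<open>A single colour \<open>r\<close> outside \<open>p\<close> and \<open>q\<close> can be
  used on both cycle edges that join the two pairs. The cycle edge inside a pair then meets the same
  two colours at both ends and takes the third one.\<close>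

lemma class1_if_outer_pairs:
  assumes k: "outer_colouring k"
    and eq: "k {v1, u1} = k {v2, u2}" "k {v3, u3} = k {v4, u4}"
  shows "class1 G"
proof -
  define p q where "p = k {v1, u1}" and "q = k {v3, u3}"
  have pq: "p < 3" "q < 3" using k outer_v by (auto simp: outer_colouring_def p_def q_def)
  have third: "\<exists>r<3. r \<noteq> i \<and> r \<noteq> j" for i j :: nat by presburger
  obtain r where r: "r < 3" "r \<noteq> p" "r \<noteq> q" using third by metis
  obtain s where s: "s < 3" "s \<noteq> p" "s \<noteq> r" using third by metis
  obtain t where t: "t < 3" "t \<noteq> q" "t \<noteq> r" using third by metis
  define col where "col e = (if e = {v1, v2} then s else if e = {v3, v4} then t
    else if e = {v2, v3} \<or> e = {v4, v1} then r else k e)" for e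
  have cv: "col {v1, v2} = s" "col {v2, v1} = s" "col {v3, v4} = t" "col {v4, v3} = t"
    "col {v2, v3} = r" "col {v3, v2} = r" "col {v1, v4} = r" "col {v4, v1} = r"
    "col {v1, u1} = p" "col {v2, u2} = p" "col {v3, u3} = q" "col {v4, u4} = q"
    using neq eq by (auto simp: col_def doubleton_eq_iff p_def q_def)
  have old: "col {w, z} = k {w, z}" if "w \<notin> {v1, v2, v3, v4}" for w z
    using that by (auto simp: col_def doubleton_eq_iff)
  show ?thesis
  proof (rule class1I[OF simple_G])
    show "col e < 3" if "e \<in> edges G" for e
      using that k r s t by (auto simp: col_def outer_colouring_def outer_def)
    fix w y z assume w: "{w, y} \<in> edges G" "{w, z} \<in> edges G" "y \<noteq> z"
    consider "w = v1" | "w = v2" | "w = v3" | "w = v4" | "w \<notin> {v1, v2, v3, v4}" by auto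
    then show "col {w, y} \<noteq> col {w, z}"
    proof cases
      case 1
      then show ?thesis using w r(2,3) s(2,3) t(2,3) unfolding 1 edge_v by (auto simp: cv)
    next
      case 2
      then show ?thesis using w r(2,3) s(2,3) t(2,3) unfolding 2 edge_v by (auto simp: cv)
    next
      case 3
      then show ?thesis using w r(2,3) s(2,3) t(2,3) unfolding 3 edge_v by (auto simp: cv)
    next
      case 4
      then show ?thesis using w r(2,3) s(2,3) t(2,3) unfolding 4 edge_v by (auto simp: cv)
    next
      case 5
      then show ?thesis using w k unfolding old[OF 5] outer_colouring_def outer_other[OF 5, symmetric]
        by simp
    qed
  qed
qed

lemma outer_colouring_rotate: "square.outer_colouring G v2 v3 v4 v1 k \<longleftrightarrow> outer_colouring k"
proof -
  interpret R: square G v2 v3 v4 v1 u2 u3 u4 u1 by (rule rotate)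
  have "R.outer = outer" by (auto simp: R.outer_def outer_def)
  then show ?thesis by (simp add: R.outer_colouring_def outer_colouring_def)
qed

text \<open>Exchanging the two colours on the Kempe chain that starts at one outer edge recolours exactly
  one of the other three.\<close>

lemma class1_if_outer_alternating:
  assumes k: "outer_colouring k"
    and eq: "k {v1, u1} = k {v3, u3}" "k {v2, u2} = k {v4, u4}" and ne: "k {v1, u1} \<noteq> k {v2, u2}"
  shows "class1 G"
proof -
  define p q where "p = k {v1, u1}" and "q = k {v2, u2}"
  \<comment> \<open>The graph of the outer edges coloured \<open>p\<close> or \<open>q\<close>. The
    corners have degree 1 in it and all other vertices degree 2, so a chain starting at a corner
    ends at another corner.\<close>
  define adj where "adj w = {u. {w, u} \<in> outer \<and> k {w, u} \<in> {p, q}}" for w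
  have pq: "p < 3" "q < 3" "p \<noteq> q" using k outer_v ne by (auto simp: outer_colouring_def p_def q_def)
  have kv: "k {v1, u1} = p" "k {v2, u2} = q" "k {v3, u3} = p" "k {v4, u4} = q"
    using eq by (simp_all add: p_def q_def)
  have adj_v: "adj v1 = {u1}" "adj v2 = {u2}" "adj v3 = {u3}" "adj v4 = {u4}"
    using kv by (auto simp: adj_def outer_v)
  \<comment> \<open>Off the 4-cycle all three edges at a vertex are outer, so each of the three
    colours occurs there exactly once.\<close>
  have adj_other: "card (adj w) = 2" if w: "w \<in> verts G" "w \<notin> {v1, v2, v3, v4}" for w
  proof -
    let ?c = "\<lambda>u. k {w, u}"
    have out: "{w, u} \<in> outer" if "u \<in> neighbours G w" for u
      using that outer_other[OF w(2)] by simp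
    have inj: "inj_on ?c (neighbours G w)"
      using k out unfolding outer_colouring_def inj_on_def by metis
    have "?c ` neighbours G w \<subseteq> {..<3}" using k out by (auto simp: outer_colouring_def)
    moreover have "card (?c ` neighbours G w) = card {..<3::nat}"
      using card_image[OF inj] cubic_card_neighbours[OF cubic_G w(1)] by simp
    ultimately have im: "?c ` neighbours G w = {..<3}" by (intro card_subset_eq) simp_all
    have "adj w = {u \<in> neighbours G w. ?c u \<in> {p, q}}"
      using outer_other[OF w(2)] by (simp add: adj_def)
    then have "?c ` adj w = ?c ` neighbours G w \<inter> {p, q}" by auto
    also have "\<dots> = {p, q}" using im pq by auto
    finally have "card (?c ` adj w) = 2" using pq by simp
    moreover have "inj_on ?c (adj w)"
      by (rule inj_on_subset[OF inj], intro subsetI) (simp add: adj_def outer_edge)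
    ultimately show ?thesis by (simp add: card_image)
  qed
  have "\<exists>K z. K \<subseteq> verts G \<and> v1 \<in> K \<and> (\<forall>w\<in>K. adj w \<subseteq> K) \<and> z \<in> K \<and> z \<noteq> v1 \<and>
    (\<forall>w\<in>K. card (adj w) = 1 \<longleftrightarrow> w = v1 \<or> w = z)"
  proof (rule kempe_chain)
    show "adj w \<subseteq> verts G - {w}" for w
      using edge_verts[OF simple_G, of w] outer_edge by (auto simp: adj_def)
    show "w \<in> adj u" if "u \<in> adj w" for u w using that by (simp add: adj_def insert_commute)
    show "card (adj w) \<le> 2" if "w \<in> verts G" for w
      using adj_other[OF that] adj_v by (cases "w \<in> {v1, v2, v3, v4}") auto
  qed (use adj_v v_verts finite_verts[OF simple_G] in auto)
  then obtain K z where K: "v1 \<in> K" "\<And>w. w \<in> K \<Longrightarrow> adj w \<subseteq> K" "z \<in> K" "z \<noteq> v1"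
    "\<And>w. w \<in> K \<Longrightarrow> card (adj w) = 1 \<longleftrightarrow> w = v1 \<or> w = z" "K \<subseteq> verts G" by metis
  have z: "z = v2 \<or> z = v3 \<or> z = v4"
    using K adj_other[of z] by fastforce
  have vK: "v2 \<in> K \<longleftrightarrow> z = v2" "v3 \<in> K \<longleftrightarrow> z = v3" "v4 \<in> K \<longleftrightarrow> z = v4"
    using K(3) K(5)[of v2] K(5)[of v3] K(5)[of v4] adj_v v_neq by auto
  define sw where "sw i = (if i = p then q else if i = q then p else i)" for i
  define k' where "k' e = (if e \<subseteq> K then sw (k e) else k e)" for e
  \<comment> \<open>Edges coloured \<open>p\<close> or \<open>q\<close> never leave
    \<open>K\<close>, and \<open>sw\<close> fixes the third colour; hence the exchange can be read
    off at either end of an edge.\<close>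
  have k'w: "k' {w, u} = (if w \<in> K then sw (k {w, u}) else k {w, u})" if "{w, u} \<in> outer" for w u
  proof (cases "k {w, u} \<in> {p, q}")
    case True
    then have "u \<in> adj w" "w \<in> adj u" using that by (auto simp: adj_def insert_commute)
    then have "w \<in> K \<longleftrightarrow> u \<in> K" using K(2) by auto
    then show ?thesis by (simp add: k'_def)
  next
    case False
    then show ?thesis by (simp add: k'_def sw_def)
  qed
  have sw_inj: "sw i = sw j \<longleftrightarrow> i = j" for i j by (auto simp: sw_def)
  have k': "outer_colouring k'"
    unfolding outer_colouring_def
  proof (intro conjI ballI allI impI)
    fix e assume "e \<in> outer"
    then have "k e < 3" using k by (simp add: outer_colouring_def)
    then show "k' e < 3" using pq by (simp add: k'_def sw_def)
  next
    fix w y z assume *: "{w, y} \<in> outer" "{w, z} \<in> outer" "y \<noteq> z"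
    then have "k {w, y} \<noteq> k {w, z}" using k by (simp add: outer_colouring_def)
    then show "k' {w, y} \<noteq> k' {w, z}" using * by (simp add: k'w sw_inj)
  qed
  have k'v: "k' {v1, u1} = q" "k' {v2, u2} = (if z = v2 then p else q)"
    "k' {v3, u3} = (if z = v3 then q else p)" "k' {v4, u4} = (if z = v4 then p else q)"
    using K(1) vK pq kv by (simp_all add: k'w outer_v sw_def)
  interpret R: square G v2 v3 v4 v1 u2 u3 u4 u1 by (rule rotate)
  \<comment> \<open>Around the cycle the new colours are q, q, p, p for \<open>z = v4\<close>; q, p,
    p, q for \<open>z = v2\<close>; and all q for \<open>z = v3\<close>. The last two patterns have
    equal pairs in the rotated square.\<close>
  show ?thesis
  proof (cases "z = v4")
    case True
    then show ?thesis using class1_if_outer_pairs[OF k'] k'v v_neq by auto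
  next
    case False
    then show ?thesis
      using R.class1_if_outer_pairs[of k'] k' k'v v_neq z by (auto simp: outer_colouring_rotate)
  qed
qed

end

lemma squareI:
  assumes "cubic G" "triangle_free G" and c: "is_cycle G [v1, v2, v3, v4]"
  obtains u1 u2 u3 u4 where "square G v1 v2 v3 v4 u1 u2 u3 u4"
proof -
  have G: "simple_graph G" using assms(1) by (rule cubic_simple)
  have d: "distinct [v1, v2, v3, v4]" and e: "{v1, v2} \<in> edges G" "{v2, v3} \<in> edges G"
    "{v3, v4} \<in> edges G" "{v4, v1} \<in> edges G"
    using c by (simp_all add: is_cycle4)
  have *: "\<exists>u. neighbours G v = {p, q, u}" if "{v, p} \<in> edges G" "{v, q} \<in> edges G" "p \<noteq> q" for v p q
    using card3_obtain[OF cubic_card_neighbours[OF assms(1) edge_verts(1)[OF G that(1)]], of p q] that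
    by (metis mem_neighbours)
  obtain u1 where u1: "neighbours G v1 = {v2, v4, u1}" using *[of v1 v2 v4] e d by (auto simp: insert_commute)
  obtain u2 where u2: "neighbours G v2 = {v1, v3, u2}" using *[of v2 v1 v3] e d by (auto simp: insert_commute)
  obtain u3 where u3: "neighbours G v3 = {v2, v4, u3}" using *[of v3 v2 v4] e d by (auto simp: insert_commute)
  obtain u4 where u4: "neighbours G v4 = {v1, v3, u4}" using *[of v4 v1 v3] e d by (auto simp: insert_commute)
  have "square G v1 v2 v3 v4 u1 u2 u3 u4" using assms(1,2) u1 u2 u3 u4 d by (rule square.intro)
  then show thesis by (rule that)
qed

text \<open>The halves at \<open>a\<close> and \<open>d\<close> inherit the colours of the
  subdivided edges. At \<open>b\<close> and at \<open>c\<close> the two path-external colours are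
  the two that differ from the colour of the middle edge. So the four outer edges of the square
  \<open>x\<close>, \<open>b\<close>, \<open>c\<close>, \<open>y\<close> either agree in
  neighbouring pairs or alternate.\<close>

lemma (in subdivided_path) class1_G:
  assumes "cubic G" "triangle_free G" "class1 H"
  shows "class1 G"
proof -
  obtain col :: "'a set \<Rightarrow> nat" where col: "\<And>e. e \<in> edges H \<Longrightarrow> col e < 3"
    "\<And>e e'. e \<in> edges H \<Longrightarrow> e' \<in> edges H \<Longrightarrow> e \<noteq> e' \<Longrightarrow> e \<inter> e' \<noteq> {} \<Longrightarrow> col e \<noteq> col e'"
    using assms(3) unfolding class1_def by metis
  have proper: "col {w, p} \<noteq> col {w, q}" if "{w, p} \<in> edges H" "{w, q} \<in> edges H" "p \<noteq> q" for w p q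
    using col(2)[OF that(1,2)] that(3) by (simp add: doubleton_eq_iff)
  have cyc: "is_cycle G [x, b, c, y]"
    using distinct_verts path_edges
    by (auto simp: is_cycle4 edge_G_iff doubleton_eq_iff insert_commute)
  obtain u1 b0 c0 u4 where S: "square G x b c y u1 b0 c0 u4"
    using squareI[OF assms(1,2) cyc] .
  then interpret S: square G x b c y u1 b0 c0 u4 .
  have u14: "u1 = a" "u4 = d"
    using S.edge_v(1)[of a] S.edge_v(4)[of d] distinct_verts edge_G_iff[of x a] edge_G_iff[of y d]
    by (auto simp: insert_commute)
  have old: "{w, p} \<in> edges H \<and> {w, p} \<noteq> {a, b} \<and> {w, p} \<noteq> {b, c} \<and> {w, p} \<noteq> {c, d}"
    if "{w, p} \<in> S.outer" "w \<notin> {x, y}" "p \<notin> {x, y}" for w p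
    using that unfolding S.outer_def by (auto simp: edge_G_iff doubleton_eq_iff)
  \<comment> \<open>Undoes the subdivision as seen from an old vertex: an edge ending in a new
    vertex stems from the edge of \<open>H\<close> that continues beyond it.\<close>
  define orig where "orig p = (if p = x then b else if p = y then c else p)" for p
  define k where "k e = (if e = {x, a} then col {a, b} else if e = {y, d} then col {c, d} else col e)" for e
  have k_old: "{w, orig p} \<in> edges H \<and> k {w, p} = col {w, orig p} \<and> (p = x \<longrightarrow> w = a) \<and> (p = y \<longrightarrow> w = d) \<and>
      (p = b \<longrightarrow> w \<noteq> a) \<and> (p = c \<longrightarrow> w \<noteq> d)"
    if wp: "{w, p} \<in> S.outer" and w: "w \<notin> {x, y}" for w p
  proof -
    consider "p = x" | "p = y" | "p \<notin> {x, y}" by auto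
    then show ?thesis
    proof cases
      case 1
      then have "w = a" using wp S.outer_v(1)[of w] u14 by (simp add: insert_commute)
      then show ?thesis using 1 path_edges distinct_verts by (auto simp: k_def orig_def insert_commute)
    next
      case 2
      then have "w = d" using wp S.outer_v(4)[of w] u14 by (simp add: insert_commute)
      then show ?thesis using 2 path_edges distinct_verts
        by (auto simp: k_def orig_def insert_commute doubleton_eq_iff)
    next
      case 3
      then show ?thesis using old[OF wp w 3] w by (auto simp: k_def orig_def doubleton_eq_iff)
    qed
  qed
  have k_x: "k {x, a} = col {a, b}" and k_y: "k {y, d} = col {c, d}"
    using distinct_verts by (auto simp: k_def doubleton_eq_iff)
  have k: "S.outer_colouring k"
    unfolding S.outer_colouring_def
  proof (intro conjI ballI allI impI)
    fix e assume e: "e \<in> S.outer"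
    then obtain w p where wp: "e = {w, p}" using edge_ex[OF simple_G] S.outer_edge by metis
    show "k e < 3"
    proof (cases "w \<in> {x, y}")
      case True
      then show ?thesis
        using e k_x k_y path_edges col(1) S.outer_v(1,4) u14 unfolding wp by auto
    next
      case False
      then show ?thesis using k_old[of w p] e col(1) unfolding wp by simp
    qed
  next
    fix w p q assume *: "{w, p} \<in> S.outer" "{w, q} \<in> S.outer" "p \<noteq> q"
    then have w: "w \<notin> {x, y}" using S.outer_v(1,4) by auto
    \<comment> \<open>Only \<open>x\<close> with \<open>b\<close>, or \<open>y\<close> with
      \<open>c\<close>, could be identified. This would force \<open>w = a\<close> or
      \<open>w = d\<close>, where the edge to \<open>b\<close> or \<open>c\<close> is gone.\<close>
    have "orig p \<noteq> orig q"
      using k_old[OF *(1) w] k_old[OF *(2) w] *(3) distinct_verts by (auto simp: orig_def)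
    then show "k {w, p} \<noteq> k {w, q}"
      using k_old[OF *(1) w] k_old[OF *(2) w] proper by simp
  qed
  have b0: "{b, b0} \<in> S.outer" "{c, c0} \<in> S.outer" by (simp_all add: S.outer_v)
  have b0_new: "b0 \<noteq> x" "b0 \<noteq> y" "c0 \<noteq> x" "c0 \<noteq> y" using S.neq by auto
  have kb: "k {b, b0} = col {b, b0}" "k {c, c0} = col {c, c0}"
    and eb: "{b, b0} \<in> edges H" "{c, c0} \<in> edges H"
    using k_old[OF b0(1)] k_old[OF b0(2)] b0_new distinct_verts by (auto simp: orig_def)
  have "b0 \<noteq> a" "b0 \<noteq> c" "c0 \<noteq> d" "c0 \<noteq> b"
    using old[OF b0(1)] old[OF b0(2)] b0_new distinct_verts by (auto simp: doubleton_eq_iff)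
  then have ne: "col {a, b} \<noteq> col {b, c}" "col {b, b0} \<noteq> col {a, b}" "col {b, b0} \<noteq> col {b, c}"
      "col {c, d} \<noteq> col {b, c}" "col {c, c0} \<noteq> col {c, d}" "col {c, c0} \<noteq> col {b, c}"
    using proper[of b a c] proper[of b b0 a] proper[of b b0 c] proper[of c d b] proper[of c c0 d]
      proper[of c c0 b] path_edges eb distinct_verts by (auto simp: insert_commute)
  have lt: "col {a, b} < 3" "col {b, c} < 3" "col {c, d} < 3" "col {b, b0} < 3" "col {c, c0} < 3"
    using col(1) path_edges eb by auto
  interpret R: square G b c y x b0 c0 u4 u1 by (rule S.rotate)
  show ?thesis
  proof (cases "col {a, b} = col {c, d}")
    case True
    then have "col {b, b0} = col {c, c0}" using ne lt by linarith
    then show ?thesis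
      using R.class1_if_outer_pairs[of k] k True kb k_x k_y u14 by (simp add: S.outer_colouring_rotate)
  next
    case False
    then have "col {b, b0} = col {c, d}" "col {c, c0} = col {a, b}" using ne lt by linarith+
    then show ?thesis using S.class1_if_outer_alternating[OF k] kb k_x k_y u14 False by simp
  qed
qed

section \<open>Reducible edge pairs\<close>

context square
begin

text \<open>After removal of the edge between \<open>v1\<close> and \<open>v2\<close>, suppression
  leaves the path \<open>u1\<close>, \<open>v4\<close>, \<open>v3\<close>, \<open>u2\<close>;
  putting \<open>v1\<close> and \<open>v2\<close> back subdivides its outer edges.\<close>

lemma subdivided_reduced: "subdivided_path (reduced G v1 v2) u1 v4 v3 u2 v1 v2 G"
proof
  let ?H = "reduced G v1 v2"
  have VH: "verts ?H = verts G - {v1, v2}" by (simp add: reduced_def)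
  have Nv: "neighbours G v1 - {v2} = {u1, v4}" "neighbours G v2 - {v1} = {v3, u2}"
    unfolding N1 N2 using neq by auto
  have EH: "edges ?H = {e \<in> edges G. v1 \<notin> e \<and> v2 \<notin> e} \<union> {{u1, v4}, {v3, u2}}"
    by (simp add: reduced_def Nv)
  show "simple_graph ?H"
    using simple_G u_verts v_verts neq
    by (auto simp: simple_graph_def VH EH)
  show "path4 ?H u1 v4 v3 u2"
    using neq by (auto simp: path4_def EH edge_v)
  show "v1 \<notin> verts ?H" "v2 \<notin> verts ?H" "v1 \<noteq> v2" using v_neq by (auto simp: VH)
  \<comment> \<open>Either edge would close a triangle in \<open>G\<close>. Hence the replacing
    edges are new and do not merge with existing ones.\<close>
  have no: "{u1, v4} \<notin> edges G" "{v3, u2} \<notin> edges G"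
    using neq by (auto simp: insert_commute[of u1] edge_v)
  define E0 D where "E0 = {e \<in> edges G. v1 \<notin> e \<and> v2 \<notin> e}"
    and "D = {{u1, v1}, {v1, v4}, {v3, v2}, {v2, u2}, {v1, v2}}"
  have "e \<in> D" if "e \<in> edges G" "v1 \<in> e \<or> v2 \<in> e" for e
  proof -
    have "\<exists>w. e = {v1, w} \<or> e = {v2, w}" using edge_ex[OF simple_G that(1)] that(2) by auto
    then obtain w where "e = {v1, w} \<or> e = {v2, w}" by metis
    then show ?thesis using that(1) edge_v(1,2)[of w] by (auto simp: insert_commute D_def)
  qed
  moreover have "D \<subseteq> edges G"
    by (simp add: D_def insert_commute[of u1] insert_commute[of v3] edge_v)
  ultimately have "edges G = E0 \<union> D" by (auto simp: E0_def)
  also have "E0 = edges ?H - {{u1, v4}, {v3, u2}}"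
    using no unfolding EH E0_def by simp
  finally have "edges G = edges ?H - {{u1, v4}, {v3, u2}} \<union>
      {{u1, v1}, {v1, v4}, {v3, v2}, {v2, u2}, {v1, v2}}" by (simp only: D_def)
  then show "G = Graph (verts ?H \<union> {v1, v2}) (edges ?H - {{u1, v4}, {v3, u2}} \<union>
      {{u1, v1}, {v1, v4}, {v3, v2}, {v2, u2}, {v1, v2}})"
    using v_verts by (intro graph_eqI) (auto simp: VH)
qed

end

section \<open>Cuts that obstruct the reduction of a 4-cycle\<close>

locale tight_square = square +
  assumes tight: "tight G"
begin

lemma rotate_tight: "tight_square G v2 v3 v4 v1 u2 u3 u4 u1"
  using rotate tight by (simp add: tight_square_def tight_square_axioms_def)

lemma reflect_tight: "tight_square G v2 v1 v4 v3 u2 u1 u4 u3"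
  using reflect tight by (simp add: tight_square_def tight_square_axioms_def)

lemma cut_lower:
  assumes "A \<subseteq> verts G" "A \<noteq> {}" "2 \<le> card (verts G - A)"
  shows "3 \<le> card (edge_cut G A)" "card A \<noteq> 1 \<Longrightarrow> 4 \<le> card (edge_cut G A)"
proof -
  have "finite A" using finite_subset[OF assms(1) finite_verts[OF simple_G]] .
  then have "card A \<noteq> 0" using assms(2) by simp
  then have big: "4 \<le> card (edge_cut G A)" if "card A \<noteq> 1"
    using that tight assms(1,3) unfolding tight_def by simp
  show "card A \<noteq> 1 \<Longrightarrow> 4 \<le> card (edge_cut G A)" by (rule big)
  show "3 \<le> card (edge_cut G A)"
  proof (cases "card A = 1")
    case True
    then obtain v where "A = {v}" by (auto simp: card_1_singleton_iff)
    then show ?thesis using card_cut_singleton[OF cubic_G, of v] assms(1) by simp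
  qed (use big in simp)
qed

lemma two_outside: "v \<in> verts G \<Longrightarrow> w \<in> verts G \<Longrightarrow> v \<noteq> w \<Longrightarrow> v \<notin> A \<Longrightarrow> w \<notin> A \<Longrightarrow> 2 \<le> card (verts G - A)"
  using card_mono[of "verts G - A" "{v, w}"] finite_verts[OF simple_G] by simp

text \<open>The obstruction to reducing \<open>v1\<close>, \<open>v2\<close>: such a cut contains
  both edges of the pair and hence at most two further ones.\<close>

definition separating :: "'a set \<Rightarrow> bool" where
  "separating X \<longleftrightarrow> X \<subseteq> verts G \<and> {v1, v4, u1, u4} \<subseteq> X \<and> X \<inter> {v2, v3, u2, u3} = {} \<and>
     card (edge_cut G X) \<le> 4"

text \<open>Otherwise moving \<open>v1\<close> and \<open>v4\<close> across would leave a cut of size 2.\<close>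

lemma separating_extend:
  assumes X: "X \<subseteq> verts G" "v1 \<in> X" "v4 \<in> X" "u1 \<in> X" "v2 \<notin> X" "v3 \<notin> X" "card (edge_cut G X) \<le> 4"
  shows "u4 \<in> X"
proof (rule ccontr)
  assume u4: "u4 \<notin> X"
  have "neighbours G v1 - X = {v2}" "neighbours G v1 \<inter> X = {v4, u1}"
    unfolding N1 using X by auto
  then have 1: "card (edge_cut G (X - {v1})) + 1 = card (edge_cut G X) + 2"
    using card_cut_remove[OF simple_G X(1,2)] neq by simp
  have s: "X - {v1} \<subseteq> verts G" "v4 \<in> X - {v1}" using X neq by auto
  have "neighbours G v4 - (X - {v1}) = {v1, v3, u4}" "neighbours G v4 \<inter> (X - {v1}) = {}"
    unfolding N4 using X u4 by auto
  then have "card (edge_cut G (X - {v1} - {v4})) + 3 = card (edge_cut G (X - {v1}))"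
    using card_cut_remove[OF simple_G s] neq by (simp only:) simp
  moreover have "3 \<le> card (edge_cut G (X - {v1} - {v4}))"
    using X neq by (intro cut_lower two_outside[OF v_verts(1,2)]) auto
  ultimately show False using 1 X(7) by linarith
qed

text \<open>A set \<open>A\<close> violating tightness extends to \<open>G\<close> in four ways,
  \<open>X p q\<close>, according to the sides of \<open>v1\<close> and \<open>v2\<close>. Each
  extension keeps both sides large, so its cut has at least four edges, against at most three in the
  reduction.\<close>

lemma separating_if_not_tight:
  assumes "\<not> tight (reduced G v1 v2)"
  obtains X where "separating X"
proof -
  define H where "H = reduced G v1 v2"
  interpret D: subdivided_path H u1 v4 v3 u2 v1 v2 G
    unfolding H_def by (rule subdivided_reduced)
  obtain A where A: "A \<subseteq> verts H" "2 \<le> card A" "2 \<le> card (verts H - A)" "card (edge_cut H A) < 4"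
    using assms unfolding tight_def H_def[symmetric] by (auto simp: not_le)
  have fG: "finite (verts G)" using finite_verts[OF simple_G] .
  define X where "X p q = A \<union> (if p then {v1} else {}) \<union> (if q then {v2} else {})" for p q
  have Xmem: "X p q \<inter> verts H = A" "v1 \<in> X p q \<longleftrightarrow> p" "v2 \<in> X p q \<longleftrightarrow> q"
    "u1 \<in> X p q \<longleftrightarrow> u1 \<in> A" "v4 \<in> X p q \<longleftrightarrow> v4 \<in> A" "v3 \<in> X p q \<longleftrightarrow> v3 \<in> A" "u2 \<in> X p q \<longleftrightarrow> u2 \<in> A" for p q
    using A(1) D.new neq by (auto simp: X_def)
  have Xsub: "X p q \<subseteq> verts G" for p q using A(1) by (auto simp: X_def D.verts_G)
  have lower: "4 \<le> card (edge_cut G (X p q))" for p q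
  proof -
    have "card A \<le> card (X p q)"
      by (rule card_mono[OF finite_subset[OF Xsub fG]]) (auto simp: X_def)
    moreover have "card (verts H - A) \<le> card (verts G - X p q)"
      using fG D.new by (intro card_mono) (auto simp: D.verts_G X_def)
    ultimately show ?thesis using A tight Xsub unfolding tight_def by simp
  qed
  have formula: "card (edge_cut G (X p q)) + of_bool (u1 \<in> A \<longleftrightarrow> v4 \<notin> A) + of_bool (v3 \<in> A \<longleftrightarrow> u2 \<notin> A) =
    card (edge_cut H A) + of_bool (u1 \<in> A \<longleftrightarrow> \<not> p) + of_bool (p \<longleftrightarrow> v4 \<notin> A) +
      of_bool (v3 \<in> A \<longleftrightarrow> \<not> q) + of_bool (q \<longleftrightarrow> u2 \<notin> A) + of_bool (p \<longleftrightarrow> \<not> q)" for p q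
    using D.cut_G[of "X p q"] by (simp only: Xmem)
  \<comment> \<open>If \<open>A\<close> separated \<open>u1\<close> from \<open>v4\<close>, then
    \<open>v1\<close> could be placed at no cost on the side wanted for \<open>v2\<close>, and the
    cut would not grow; likewise for \<open>v3\<close> and \<open>u2\<close>. If all four were on
    one side, \<open>v1\<close> and \<open>v2\<close> could join them for free.\<close>
  have sides: "(u1 \<in> A \<longleftrightarrow> v4 \<in> A) \<and> (u2 \<in> A \<longleftrightarrow> v3 \<in> A) \<and> (v4 \<in> A \<longleftrightarrow> v3 \<notin> A)"
    using formula[of True True] formula[of True False] formula[of False True] formula[of False False]
      lower[of True True] lower[of True False] lower[of False True] lower[of False False] A(4)
    by (cases "u1 \<in> A"; cases "v4 \<in> A"; cases "v3 \<in> A"; cases "u2 \<in> A"; simp)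
  have small: "card (edge_cut G (X (v4 \<in> A) (v3 \<in> A))) \<le> 4"
    using formula[of "v4 \<in> A" "v3 \<in> A"] sides A(4) by (cases "v4 \<in> A") auto
  \<comment> \<open>Complementation, if necessary, puts \<open>v1\<close> and \<open>v4\<close>
    inside.\<close>
  define Y where "Y = (if v4 \<in> A then X True False else verts G - X False True)"
  have Y: "Y \<subseteq> verts G" "v1 \<in> Y" "v4 \<in> Y" "u1 \<in> Y" "v2 \<notin> Y" "v3 \<notin> Y" "u2 \<notin> Y" "card (edge_cut G Y) \<le> 4"
    using small sides Xsub v_verts u_verts cut_compl[OF simple_G] by (auto simp: Y_def Xmem)
  have "u4 \<in> Y" using separating_extend[OF Y(1-6,8)] .
  moreover interpret R: tight_square G v2 v1 v4 v3 u2 u1 u4 u3 by (rule reflect_tight)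
  have "u3 \<in> verts G - Y"
    using Y v_verts u_verts cut_compl[OF simple_G, of Y] by (intro R.separating_extend) auto
  ultimately have "separating Y" using Y by (simp add: separating_def)
  then show thesis by (rule that)
qed

text \<open>Two neighbours of \<open>v1\<close> are outside \<open>Q\<close> and only
  \<open>u1\<close> is inside, so dropping \<open>v1\<close> saves exactly one edge. What remains
  contains \<open>u1\<close>: its cut has at least 3 edges, and at least 4 unless \<open>u1\<close>
  is alone.\<close>

lemma quadrant:
  assumes Q: "Q \<subseteq> verts G" "v1 \<in> Q" "u1 \<in> Q" "v2 \<notin> Q" "v4 \<notin> Q"
  shows "4 \<le> card (edge_cut G Q)" "card (edge_cut G Q) \<le> 4 \<Longrightarrow> Q = {v1, u1}"
proof -
  have "neighbours G v1 - Q = {v2, v4}" "neighbours G v1 \<inter> Q = {u1}"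
    unfolding N1 using Q by auto
  then have eq: "card (edge_cut G (Q - {v1})) + 2 = card (edge_cut G Q) + 1"
    using card_cut_remove[OF simple_G Q(1,2)] v_neq by simp
  have *: "Q - {v1} \<subseteq> verts G" "Q - {v1} \<noteq> {}" "2 \<le> card (verts G - (Q - {v1}))"
    using Q u1_new v_neq by (auto intro!: two_outside[OF v_verts(1,2)])
  show "4 \<le> card (edge_cut G Q)" using cut_lower(1)[OF *] eq by linarith
  assume "card (edge_cut G Q) \<le> 4"
  then have "card (Q - {v1}) = 1" using cut_lower(2)[OF *] eq by linarith
  then obtain w where w: "Q - {v1} = {w}" by (auto simp: card_1_singleton_iff)
  have "u1 \<in> Q - {v1}" using Q(3) u1_new(1) by simp
  then have "Q - {v1} = {u1}" using w by simp
  then show "Q = {v1, u1}" using insert_Diff[OF Q(2)] by simp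
qed

text \<open>Otherwise \<open>u1\<close> and \<open>u4\<close> would each send two edges out of
  \<open>X\<close>, and with the edges from \<open>v1\<close> to \<open>v2\<close> and from
  \<open>v4\<close> to \<open>v3\<close> the cut would have at least six.\<close>

lemma outer_edge_if_separating:
  assumes X: "X = {v1, u1, v4, u4}" "separating X"
  shows "{u1, u4} \<in> edges G"
proof (rule ccontr)
  assume no: "{u1, u4} \<notin> edges G"
  have out: "2 \<le> card (neighbours G p - X)" if "p \<in> verts G" "neighbours G p \<inter> X \<subseteq> {w}" for p w
  proof -
    have "card (neighbours G p \<inter> X) \<le> 1" using card_mono[OF _ that(2)] by simp
    moreover have "card (neighbours G p) = card (neighbours G p \<inter> X) + card (neighbours G p - X)"
      using finite_neighbours[OF simple_G] by (metis card_Int_Diff)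
    ultimately show ?thesis using cubic_card_neighbours[OF cubic_G that(1)] by linarith
  qed
  have ne: "u1 \<noteq> u4" "v1 \<noteq> u1" "v1 \<noteq> v4" "v1 \<noteq> u4" "u1 \<noteq> v4" "v4 \<noteq> u4" using neq by auto
  have "{u1, v4} \<notin> edges G" "{u4, v1} \<notin> edges G"
    using neq by (auto simp: insert_commute[of u1] insert_commute[of u4] edge_v)
  moreover have "{u1, u1} \<notin> edges G" "{u4, u4} \<notin> edges G" "{u4, u1} \<notin> edges G"
    using no not_self_neighbour[OF simple_G, of u1] not_self_neighbour[OF simple_G, of u4]
    by (simp_all add: insert_commute)
  ultimately have "neighbours G u1 \<inter> X \<subseteq> {v1}" "neighbours G u4 \<inter> X \<subseteq> {v4}"
    unfolding X(1) using no by auto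
  then have "2 \<le> card (neighbours G u1 - X)" "2 \<le> card (neighbours G u4 - X)"
    using out u_verts by metis+
  moreover have "v2 \<notin> X" "v3 \<notin> X" using X(2) by (auto simp: separating_def)
  then have "neighbours G v1 - X = {v2}" "neighbours G v4 - X = {v3}"
    unfolding N1 N4 X(1) by auto
  moreover have "card (edge_cut G X) = (\<Sum>p\<in>X. card (neighbours G p - X))"
    using X(2) by (intro card_cut simple_G) (simp add: separating_def)
  then have "card (edge_cut G X) = card (neighbours G v1 - X) + card (neighbours G u1 - X) +
      card (neighbours G v4 - X) + card (neighbours G u4 - X)"
    unfolding X(1) using ne by (simp add: add.assoc)
  ultimately show False using X(2) by (simp add: separating_def)
qed

lemma separating_compl:
  assumes "separating X"
  shows "tight_square.separating G v2 v1 v4 v3 u2 u1 u4 u3 (verts G - X)"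
proof -
  interpret R: tight_square G v2 v1 v4 v3 u2 u1 u4 u3 by (rule reflect_tight)
  show ?thesis
    using assms v_verts u_verts cut_compl[OF simple_G, of X]
    by (auto simp: separating_def R.separating_def)
qed

text \<open>By submodularity the cuts around opposite quadrants have total size at most 8, whereas each of
  them has size at least 4, with equality only around a pair of vertices.\<close>

lemma crossing_quadrants:
  assumes X: "separating X" and Z: "tight_square.separating G v2 v3 v4 v1 u2 u3 u4 u1 Z"
  shows "X \<inter> Z = {v1, u1}" "(verts G - X) \<inter> Z = {v2, u2}"
    "(verts G - X) \<inter> (verts G - Z) = {v3, u3}" "X \<inter> (verts G - Z) = {v4, u4}"
proof -
  interpret R1: tight_square G v2 v3 v4 v1 u2 u3 u4 u1 by (rule rotate_tight)
  interpret R2: tight_square G v3 v4 v1 v2 u3 u4 u1 u2 by (rule R1.rotate_tight)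
  interpret R3: tight_square G v4 v1 v2 v3 u4 u1 u2 u3 by (rule R2.rotate_tight)
  let ?d = "\<lambda>A. card (edge_cut G A)"
  have X': "X \<subseteq> verts G" "v1 \<in> X" "v4 \<in> X" "u1 \<in> X" "u4 \<in> X" "v2 \<notin> X" "v3 \<notin> X" "u2 \<notin> X" "u3 \<notin> X" "?d X \<le> 4"
    using X by (auto simp: separating_def)
  have Z': "Z \<subseteq> verts G" "v2 \<in> Z" "v1 \<in> Z" "u2 \<in> Z" "u1 \<in> Z" "v3 \<notin> Z" "v4 \<notin> Z" "u3 \<notin> Z" "u4 \<notin> Z" "?d Z \<le> 4"
    using Z by (auto simp: R1.separating_def)
  define Q1 Q2 Q3 Q4 where "Q1 = X \<inter> Z" and "Q2 = (verts G - X) \<inter> Z"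
    and "Q3 = (verts G - X) \<inter> (verts G - Z)" and "Q4 = X \<inter> (verts G - Z)"
  note Q_defs = Q1_def Q2_def Q3_def Q4_def
  have Q1: "Q1 \<subseteq> verts G" "v1 \<in> Q1" "u1 \<in> Q1" "v2 \<notin> Q1" "v4 \<notin> Q1"
    using X' Z' by (auto simp: Q1_def)
  have Q2: "Q2 \<subseteq> verts G" "v2 \<in> Q2" "u2 \<in> Q2" "v3 \<notin> Q2" "v1 \<notin> Q2"
    using X' Z' v_verts u_verts by (auto simp: Q2_def)
  have Q3: "Q3 \<subseteq> verts G" "v3 \<in> Q3" "u3 \<in> Q3" "v4 \<notin> Q3" "v2 \<notin> Q3"
    using X' Z' v_verts u_verts by (auto simp: Q3_def)
  have Q4: "Q4 \<subseteq> verts G" "v4 \<in> Q4" "u4 \<in> Q4" "v1 \<notin> Q4" "v3 \<notin> Q4"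
    using X' Z' v_verts u_verts by (auto simp: Q4_def)
  note lower = quadrant(1)[OF Q1] R1.quadrant(1)[OF Q2] R2.quadrant(1)[OF Q3] R3.quadrant(1)[OF Q4]
  \<comment> \<open>Complementation turns the unions in the submodular inequality into the opposite
    quadrants.\<close>
  have "verts G - (X \<union> Z) = Q3" "verts G - ((verts G - X) \<union> Z) = Q4"
    using X'(1) by (auto simp: Q_defs)
  then have "?d (X \<union> Z) = ?d Q3" "?d ((verts G - X) \<union> Z) = ?d Q4"
    using cut_compl[OF simple_G] by metis+
  then have "?d Q1 + ?d Q3 \<le> 8" "?d Q2 + ?d Q4 \<le> 8"
    using cut_submodular[OF simple_G, of X Z] cut_submodular[OF simple_G, of "verts G - X" Z]
      cut_compl[OF simple_G, of X] X'(10) Z'(10) by (simp_all add: Q1_def Q2_def)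
  then have upper: "?d Q1 \<le> 4" "?d Q2 \<le> 4" "?d Q3 \<le> 4" "?d Q4 \<le> 4"
    using lower by linarith+
  show "X \<inter> Z = {v1, u1}" using quadrant(2)[OF Q1 upper(1)] by (simp only: Q1_def)
  show "(verts G - X) \<inter> Z = {v2, u2}" using R1.quadrant(2)[OF Q2 upper(2)] by (simp only: Q2_def)
  show "(verts G - X) \<inter> (verts G - Z) = {v3, u3}" using R2.quadrant(2)[OF Q3 upper(3)] by (simp only: Q3_def)
  show "X \<inter> (verts G - Z) = {v4, u4}" using R3.quadrant(2)[OF Q4 upper(4)] by (simp only: Q4_def)
qed

text \<open>The edges between the two 4-cycles take colour 2, and each 4-cycle alternates between 0
  and 1.\<close>

lemma class1_if_cube:
  assumes V: "verts G = {v1, u1, v2, u2, v3, u3, v4, u4}"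
    and ne: "u1 \<noteq> u3" "u2 \<noteq> u4"
    and e: "{u1, u2} \<in> edges G" "{u2, u3} \<in> edges G" "{u3, u4} \<in> edges G" "{u4, u1} \<in> edges G"
  shows "class1 G"
proof -
  have nb: "neighbours G u = {v, p, q}"
    if "{u, v} \<in> edges G" "{u, p} \<in> edges G" "{u, q} \<in> edges G" "v \<noteq> p" "v \<noteq> q" "p \<noteq> q" for u v p q
  proof (rule card_subset_eq[symmetric])
    show "finite (neighbours G u)" by (rule finite_neighbours[OF simple_G])
    show "{v, p, q} \<subseteq> neighbours G u" using that by simp
    have "card (neighbours G u) = 3"
      using cubic_card_neighbours[OF cubic_G edge_verts(1)[OF simple_G that(1)]] .
    then show "card {v, p, q} = card (neighbours G u)" using that by simp
  qed
  have spokes: "{u1, v1} \<in> edges G" "{u2, v2} \<in> edges G" "{u3, v3} \<in> edges G" "{u4, v4} \<in> edges G"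
    by (simp_all add: insert_commute[of u1] insert_commute[of u2] insert_commute[of u3] insert_commute[of u4] edge_v)
  have e': "{u2, u1} \<in> edges G" "{u3, u2} \<in> edges G" "{u4, u3} \<in> edges G" "{u1, u4} \<in> edges G"
    using e by (simp_all add: insert_commute)
  have "neighbours G u1 = {v1, u2, u4}" "neighbours G u2 = {v2, u1, u3}"
    "neighbours G u3 = {v3, u2, u4}" "neighbours G u4 = {v4, u1, u3}"
    using nb[of u1 v1 u2 u4] nb[of u2 v2 u1 u3] nb[of u3 v3 u2 u4] nb[of u4 v4 u1 u3]
      spokes e e' ne neq by simp_all
  then have edge_u: "{u1, w} \<in> edges G \<longleftrightarrow> w \<in> {v1, u2, u4}" "{u2, w} \<in> edges G \<longleftrightarrow> w \<in> {v2, u1, u3}"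
    "{u3, w} \<in> edges G \<longleftrightarrow> w \<in> {v3, u2, u4}" "{u4, w} \<in> edges G \<longleftrightarrow> w \<in> {v4, u1, u3}" for w
    using mem_neighbours by metis+
  define col :: "'a set \<Rightarrow> nat" where
    "col f = (if f \<in> {{v1, u1}, {v2, u2}, {v3, u3}, {v4, u4}} then 2
      else if f \<in> {{v1, v2}, {v3, v4}, {u1, u2}, {u3, u4}} then 0 else 1)" for f
  show ?thesis
  proof (rule class1I[OF simple_G])
    show "col f < 3" for f by (simp add: col_def)
    fix w p q assume w: "{w, p} \<in> edges G" "{w, q} \<in> edges G" "p \<noteq> q"
    have "w \<in> verts G" using edge_verts[OF simple_G w(1)] by simp
    then consider "w = v1" | "w = v2" | "w = v3" | "w = v4" | "w = u1" | "w = u2" | "w = u3" | "w = u4"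
      unfolding V by auto
    then show "col {w, p} \<noteq> col {w, q}"
      using w neq ne ne[symmetric]
      by cases (auto simp: edge_v edge_u col_def doubleton_eq_iff)
  qed
qed

lemma tight_reduction:
  assumes "class2 G"
  shows "tight (reduced G v1 v2) \<or> tight (reduced G v2 v3)"
proof (rule ccontr)
  assume no: "\<not> (tight (reduced G v1 v2) \<or> tight (reduced G v2 v3))"
  interpret R1: tight_square G v2 v3 v4 v1 u2 u3 u4 u1 by (rule rotate_tight)
  interpret Rf: tight_square G v2 v1 v4 v3 u2 u1 u4 u3 by (rule reflect_tight)
  interpret R1f: tight_square G v3 v2 v1 v4 u3 u2 u1 u4 by (rule R1.reflect_tight)
  obtain X where X: "separating X" using separating_if_not_tight no by metis
  obtain Z where Z: "R1.separating Z" using R1.separating_if_not_tight no by metis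
  have sub: "X \<subseteq> verts G" "Z \<subseteq> verts G"
    using X Z by (simp_all add: separating_def R1.separating_def)
  note Q = crossing_quadrants[OF X Z]
  \<comment> \<open>Each side of either cut is the union of two neighbouring quadrants and so yields
    one edge of the outer 4-cycle.\<close>
  have "X = X \<inter> Z \<union> X \<inter> (verts G - Z)" using sub by auto
  then have "X = {v1, u1, v4, u4}" unfolding Q by auto
  from outer_edge_if_separating[OF this X] have e41: "{u4, u1} \<in> edges G" by (simp add: insert_commute)
  have "verts G - X = (verts G - X) \<inter> Z \<union> (verts G - X) \<inter> (verts G - Z)" using sub by auto
  then have "verts G - X = {v2, u2, v3, u3}" unfolding Q by auto
  from Rf.outer_edge_if_separating[OF this separating_compl[OF X]] have e23: "{u2, u3} \<in> edges G" .
  have "Z = X \<inter> Z \<union> (verts G - X) \<inter> Z" using sub by auto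
  then have "Z = {v2, u2, v1, u1}" unfolding Q by auto
  from R1.outer_edge_if_separating[OF this Z] have e12: "{u1, u2} \<in> edges G" by (simp add: insert_commute)
  have "verts G - Z = (verts G - X) \<inter> (verts G - Z) \<union> X \<inter> (verts G - Z)" using sub by auto
  then have "verts G - Z = {v3, u3, v4, u4}" unfolding Q by auto
  from R1f.outer_edge_if_separating[OF this R1.separating_compl[OF Z]] have e34: "{u3, u4} \<in> edges G" .
  have "verts G = X \<inter> Z \<union> (verts G - X) \<inter> Z \<union> (verts G - X) \<inter> (verts G - Z) \<union> X \<inter> (verts G - Z)"
    using sub by auto
  then have V: "verts G = {v1, u1, v2, u2, v3, u3, v4, u4}" unfolding Q by auto
  have "u1 \<noteq> u3" "u2 \<noteq> u4" using X Z by (auto simp: separating_def R1.separating_def)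
  from class1_if_cube[OF V this e12 e23 e34 e41] show False using assms by simp
qed

end

text \<open>The colour classes are the three perfect matchings of the complete graph on four
  vertices.\<close>

lemma class1_if_K4:
  assumes H: "simple_graph H" and V: "verts H \<subseteq> {u, v, w, t}" and d: "distinct [u, v, w, t]"
  shows "class1 H"
proof -
  define col :: "'a set \<Rightarrow> nat" where
    "col e = (if e \<in> {{u, v}, {w, t}} then 0 else if e \<in> {{u, w}, {v, t}} then 1 else 2)" for e
  have cv: "col {u, v} = 0" "col {v, u} = 0" "col {w, t} = 0" "col {t, w} = 0"
    "col {u, w} = 1" "col {w, u} = 1" "col {v, t} = 1" "col {t, v} = 1"
    "col {u, t} = 2" "col {t, u} = 2" "col {v, w} = 2" "col {w, v} = 2"
    using d by (auto simp: col_def doubleton_eq_iff)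
  show ?thesis
  proof (rule class1I[OF H])
    show "col e < 3" for e by (simp add: col_def)
    fix r p q assume e: "{r, p} \<in> edges H" "{r, q} \<in> edges H" "p \<noteq> q"
    have mem: "r \<in> {u, v, w, t}" "p \<in> {u, v, w, t}" "q \<in> {u, v, w, t}" "r \<noteq> p" "r \<noteq> q"
      using edge_verts[OF H e(1)] edge_verts[OF H e(2)] V by (blast | simp)+
    show "col {r, p} \<noteq> col {r, q}"
      using mem e(3) by (auto simp: cv)
  qed
qed

text \<open>Each corner of a triangle has one neighbour outside it, so the cut has three edges.
  Tightness then leaves a single further vertex, and four vertices are too few for class 2.\<close>

lemma triangle_free_if_tight:
  assumes H: "cubic H" "tight H" "class2 H"
  shows "triangle_free H"
proof (rule ccontr)
  assume "\<not> triangle_free H"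
  then obtain u v w where e: "{u, v} \<in> edges H" "{v, w} \<in> edges H" "{u, w} \<in> edges H"
    unfolding triangle_free_iff by metis
  have sH: "simple_graph H" using H(1) by (rule cubic_simple)
  note fH = finite_verts[OF sH]
  let ?A = "{u, v, w}"
  have uvw: "u \<noteq> v" "v \<noteq> w" "u \<noteq> w" "u \<in> verts H" "v \<in> verts H" "w \<in> verts H"
    using edge_verts[OF sH e(1)] edge_verts[OF sH e(2)] edge_verts[OF sH e(3)] by auto
  have one: "card (neighbours H p - ?A) = 1" if "?A = {p, q, r}" "q \<noteq> r" "{p, q} \<in> edges H" "{p, r} \<in> edges H" for p q r
  proof -
    have "neighbours H p \<inter> ?A = {q, r}"
      unfolding that(1) using that(3,4) not_self_neighbour[OF sH, of p] by auto
    moreover have "card (neighbours H p) = card (neighbours H p \<inter> ?A) + card (neighbours H p - ?A)"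
      using finite_neighbours[OF sH] by (metis card_Int_Diff)
    moreover have "card (neighbours H p) = 3"
      using cubic_card_neighbours[OF H(1) edge_verts(1)[OF sH that(3)]] .
    ultimately show ?thesis using that(2) by simp
  qed
  have ones: "card (neighbours H u - ?A) = 1" "card (neighbours H v - ?A) = 1" "card (neighbours H w - ?A) = 1"
    using one[of u v w] one[of v u w] one[of w u v] uvw e by (simp_all add: insert_commute)
  have "card (edge_cut H ?A) = 3"
    using ones uvw by (subst card_cut[OF sH]) simp_all
  then have "card (verts H - ?A) < 2"
    using H(2)[unfolded tight_def, rule_format, of ?A] uvw by fastforce
  moreover have "neighbours H u - ?A \<subseteq> verts H - ?A"
    using neighbours_subset[OF sH, of u] by (rule Diff_mono) simp
  then have "1 \<le> card (verts H - ?A)"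
    using card_mono[of "verts H - ?A" "neighbours H u - ?A"] fH ones(1) by simp
  ultimately have "card (verts H - ?A) = 1" by linarith
  then obtain t where t: "verts H - ?A = {t}" by (auto simp: card_1_singleton_iff)
  then have "t \<notin> ?A" by auto
  then have "distinct [u, v, w, t]" using uvw by auto
  moreover have "verts H \<subseteq> ?A \<union> (verts H - ?A)" by auto
  then have "verts H \<subseteq> {u, v, w, t}" unfolding t by auto
  ultimately show False using class1_if_K4[OF sH] H(3) by metis
qed

section \<open>Snarks, their reductions and the domain of the choice\<close>

lemma snarkI:
  assumes "cubic H" "tight H" "class2 H"
  shows "snark H"
proof -
  have "4 \<le> girth H"
    using triangle_free_if_tight[OF assms] triangle_free_iff_girth[OF cubic_simple[OF assms(1)]] by simp
  then have "girth H = 4 \<or> 5 \<le> girth H"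
    using ileI1[of 4 "girth H"] by (auto simp: eSuc_numeral le_less)
  then show ?thesis
    using assms by (auto simp: snark_def g4_snark_def proper_snark_def tight_iff_cyclically_connected)
qed

lemma snarkD:
  assumes "snark H"
  shows "cubic H" "tight H" "class2 H" "triangle_free H"
proof -
  show *: "cubic H" "tight H" "class2 H"
    using assms by (auto simp: snark_def g4_snark_def proper_snark_def tight_iff_cyclically_connected)
  show "triangle_free H" using triangle_free_if_tight[OF *] .
qed

lemma (in square) edge_pair_in_E2:
  assumes "tight (reduced G v1 v2)"
  shows "{{v1, v2}, {v3, v4}} \<in> E2 G"
proof -
  interpret D: subdivided_path "reduced G v1 v2" u1 v4 v3 u2 v1 v2 G by (rule subdivided_reduced)
  have "cubic (reduced G v1 v2)" using cubic_G D.cubic_iff by simp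
  then have "cyclically_connected 4 (reduced G v1 v2)"
    using assms tight_iff_cyclically_connected by metis
  moreover have "reduced G v1 v2 \<in> reductions G {{v1, v2}, {v3, v4}}"
    unfolding reductions_def using suppress_suppress[OF v_neq(1), of G]
    by (intro CollectI exI[of _ v1] exI[of _ v2]) simp
  moreover have "is_cycle G [v1, v2, v3, v4]" using v_distinct by (simp add: is_cycle4 edge_v)
  then have "edge_pair G {{v1, v2}, {v3, v4}}" unfolding edge_pair_def by metis
  ultimately show ?thesis unfolding E2_def by auto
qed

lemma g4_snark_choice_domain:
  assumes "g4_snark G"
  shows "choice_domain G"
proof -
  have G: "cubic G" "class2 G" "girth G = 4" "cyclically_connected 4 G"
    using assms by (auto simp: g4_snark_def)
  have "snark G" using assms by (simp add: snark_def)
  note D = snarkD[OF this]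
  obtain v1 v2 v3 v4 where c: "is_cycle G [v1, v2, v3, v4]" using girth4_cycle[OF G(3)] .
  obtain u1 u2 u3 u4 where "square G v1 v2 v3 v4 u1 u2 u3 u4" using squareI[OF D(1,4) c] .
  then interpret S: tight_square G v1 v2 v3 v4 u1 u2 u3 u4
    using D(2) by (simp add: tight_square_def tight_square_axioms_def)
  interpret R: square G v2 v3 v4 v1 u2 u3 u4 u1 by (rule S.rotate)
  have "E2 G \<noteq> {}"
    using S.tight_reduction[OF G(2)] S.edge_pair_in_E2 R.edge_pair_in_E2 by auto
  then show ?thesis using G by (simp add: choice_domain_def)
qed

text \<open>The graph \<open>H\<close> is itself one of the reductions of the defining pair. The
  choice is thus constrained on every result, before its class is tested.\<close>

lemma (in doubling) choice_domain_G:
  assumes "tight H"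
  shows "choice_domain G" "{{x, y}, {b, c}} \<in> E2 G"
proof -
  have "cyclically_connected 4 H" "cyclically_connected 4 G"
    using assms tight_G cubic_H cubic_G tight_iff_cyclically_connected by metis+
  moreover show "{{x, y}, {b, c}} \<in> E2 G"
    using calculation edge_pair_G unfolding E2_def by (auto simp: reductions_G)
  ultimately show "choice_domain G"
    using cubic_G girth_G by (auto simp: choice_domain_def)
qed

text \<open>Either edge of the pair may have been the one removed; the second choice is the first
  one in the square rotated twice.\<close>

lemma reduction_of_g4_snark:
  assumes G: "g4_snark G" and q: "q \<in> E2 G"
  obtains R a b c d x y where "snark R" "doubling R a b c d x y G" "q = {{x, y}, {b, c}}"
proof -
  have "snark G" using G by (simp add: snark_def)
  note D = snarkD[OF this]
  obtain v1 v2 v3 v4 R where c: "is_cycle G [v1, v2, v3, v4]" and q_eq: "q = {{v1, v2}, {v3, v4}}"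
    and R: "R \<in> reductions G q" "cyclically_connected 4 R"
    using q unfolding E2_def edge_pair_def by auto
  obtain u1 u2 u3 u4 where "square G v1 v2 v3 v4 u1 u2 u3 u4" using squareI[OF D(1,4) c] .
  then interpret S: square G v1 v2 v3 v4 u1 u2 u3 u4 .
  interpret R1: square G v2 v3 v4 v1 u2 u3 u4 u1 by (rule S.rotate)
  interpret R2: square G v3 v4 v1 v2 u3 u4 u1 u2 by (rule R1.rotate)
  note intro = that
  have fin: thesis if sub: "subdivided_path R a b c d x y G" and q: "q = {{x, y}, {b, c}}" for a b c d x y
  proof -
    interpret P: subdivided_path R a b c d x y G by (rule sub)
    have "cubic R" using D(1) P.cubic_iff by simp
    moreover from this have "tight R" using R(2) tight_iff_cyclically_connected by metis
    moreover have "class2 R" using P.class1_G D by metis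
    ultimately have "snark R" by (rule snarkI)
    moreover have "doubling R a b c d x y G"
      using snarkD(1,4)[OF calculation] sub by (simp add: doubling_def doubling_axioms_def)
    ultimately show thesis using q intro by metis
  qed
  obtain x y where xy: "{x, y} \<in> q" "R = suppress (suppress (delete_edges G {{x, y}}) x) y"
    using R(1) unfolding reductions_def by auto
  have "x \<noteq> y" using xy(1) S.v_neq unfolding q_eq by (auto simp: doubleton_eq_iff)
  then have "R = reduced G x y" using xy(2) suppress_suppress by metis
  then have "R = reduced G v1 v2 \<or> R = reduced G v3 v4"
    using xy(1) reduced_commute[of G v2 v1] reduced_commute[of G v4 v3] unfolding q_eq by (auto simp: doubleton_eq_iff)
  then show thesis
  proof
    assume "R = reduced G v1 v2"
    then show thesis using fin[of u1 v4 v3 u2 v1 v2] S.subdivided_reduced q_eq by (simp add: insert_commute)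
  next
    assume "R = reduced G v3 v4"
    then show thesis using fin[of u3 v2 v1 u4 v3 v4] R2.subdivided_reduced q_eq by (simp add: insert_commute)
  qed
qed

section \<open>Operations and the canonical choice\<close>

text \<open>With the identity for \<open>f\<close>, this says that the names of the new vertices do
  not matter; with a general \<open>f\<close>, it moves an operation to the chosen representative of
  its graph.\<close>

lemma operation_iso:
  assumes "C \<in> operations H" "C' \<in> operations H'" "graph_iso f H H'" "map_edges f (snd C) = snd C'"
    and "edge_doubling C G p" "edge_doubling C' G' p'"
  obtains g where "graph_iso g G G'" "map_edges g p = p'"
proof -
  obtain a b c d x y where D: "doubling H a b c d x y G" "p = {{x, y}, {b, c}}"
    "C = (H, {{a, b}, {b, c}, {c, d}})"
    using doubling_from_operation[OF assms(1,5)] .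
  obtain a' b' c' d' x' y' where D': "doubling H' a' b' c' d' x' y' G'" "p' = {{x', y'}, {b', c'}}"
    "C' = (H', {{a', b'}, {b', c'}, {c', d'}})"
    using doubling_from_operation[OF assms(2,6)] .
  interpret D: doubling H a b c d x y G by (rule D(1))
  interpret D': doubling H' a' b' c' d' x' y' G' by (rule D'(1))
  have "map_edges f {{a, b}, {b, c}, {c, d}} = {{a', b'}, {b', c'}, {c', d'}}"
    using assms(4) D(3) D'(3) by simp
  from D.extend_iso_path[OF assms(3) D'.subdivided_path_axioms this] obtain g
    where "graph_iso g G G'" "map_edges g {{x, y}, {b, c}} = {{x', y'}, {b', c'}}" .
  then show thesis using that D(2) D'(2) by metis
qed

lemma (in doubling) operation: "(H, {{a, b}, {b, c}, {c, d}}) \<in> operations H"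
  unfolding operations_def
  using cubic_H path triangle_free_iff_girth[OF simple_H] tf_H
  by (intro CollectI exI[of _ "{{a, b}, {b, c}, {c, d}}"] conjI exI[of _ a] exI[of _ b] exI[of _ c] exI[of _ d])
    simp_all

lemma operation_image:
  assumes C: "(H, P) \<in> operations H" and f: "graph_iso f H H'" and H': "cubic H'" "4 \<le> girth H'"
  shows "(H', map_edges f P) \<in> operations H'"
proof -
  have H: "cubic H" using C unfolding operations_def by (elim CollectE exE conjE) simp
  obtain a b c d where path: "path4 H a b c d" and P: "P = {{a, b}, {b, c}, {c, d}}"
    using C unfolding operations_def by (elim CollectE exE conjE) simp
  have sH: "simple_graph H" using H by (rule cubic_simple)
  have e: "{a, b} \<in> edges H" "{b, c} \<in> edges H" "{c, d} \<in> edges H" and dist: "distinct [a, b, c, d]"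
    using path by (auto simp: path4_def)
  have v: "a \<in> verts H" "b \<in> verts H" "c \<in> verts H" "d \<in> verts H"
    using edge_verts[OF sH e(1)] edge_verts[OF sH e(3)] by auto
  have "path4 H' (f a) (f b) (f c) (f d)"
    using edge_iso_iff[OF sH f] e v dist inj_on_eq_iff[OF graph_iso_inj[OF f]] by (auto simp: path4_def)
  moreover have "map_edges f P = {{f a, f b}, {f b, f c}, {f c, f d}}" by (simp add: P map_edges_def)
  ultimately show ?thesis using H' unfolding operations_def
    by (intro CollectI exI[of _ "map_edges f P"] conjI exI[of _ "f a"] exI[of _ "f b"] exI[of _ "f c"] exI[of _ "f d"])
      simp_all
qed

section \<open>The chosen orbit under isomorphisms\<close>

lemma E2_subset: "p \<in> E2 G \<Longrightarrow> p \<subseteq> edges G"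
  by (auto simp: E2_def edge_pair_def is_cycle4)

lemma canonical_choice_orbit:
  assumes "canonical_choice \<chi>" "choice_domain G"
  obtains p where "p \<in> E2 G" "\<chi> G = edge_pair_orbit G p"
  using assms unfolding canonical_choice_def by metis

lemma canonical_choice_iso:
  assumes "canonical_choice \<chi>" "choice_domain G" "choice_domain G'" "isomorphic G G'"
  obtains f where "graph_iso f G G'" "map_edges f ` \<chi> G = \<chi> G'"
  using assms unfolding canonical_choice_def by metis

text \<open>The route from \<open>p\<close> to \<open>q\<close> goes back to the base point
  \<open>r\<close> of the orbit and on from there. The inverse is taken relative to
  \<open>verts G\<close>, as an automorphism is injective only there.\<close>

lemma canonical_choice_transitive:
  assumes \<chi>: "canonical_choice \<chi>" and G: "choice_domain G" and pq: "p \<in> \<chi> G" "q \<in> \<chi> G"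
  obtains f where "graph_iso f G G" "map_edges f p = q"
proof -
  obtain r where r: "r \<in> E2 G" "\<chi> G = edge_pair_orbit G r"
    using canonical_choice_orbit[OF \<chi> G] .
  obtain f g where f: "graph_iso f G G" "p = map_edges f r" and g: "graph_iso g G G" "q = map_edges g r"
    using pq unfolding r(2) edge_pair_orbit_def by auto
  have sG: "simple_graph G" using G cubic_simple by (auto simp: choice_domain_def)
  let ?i = "inv_into (verts G) f"
  have "r \<subseteq> Pow (verts G)" using E2_subset[OF r(1)] simple_edge_subset[OF sG] by auto
  then have "map_edges ?i p = r" using map_edges_inv[OF graph_iso_inj[OF f(1)]] f(2) by simp
  then have "map_edges (g \<circ> ?i) p = q" using g(2) by (simp add: map_edges_comp)
  moreover have "graph_iso (g \<circ> ?i) G G"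
    using graph_iso_comp[OF graph_iso_inv[OF sG f(1)] g(1)] .
  ultimately show thesis using that by metis
qed

lemma canonical_choice_invariant:
  assumes \<chi>: "canonical_choice \<chi>" and G: "choice_domain G" and p: "p \<in> \<chi> G" and f: "graph_iso f G G"
  shows "map_edges f p \<in> \<chi> G"
proof -
  obtain r where r: "\<chi> G = edge_pair_orbit G r" using canonical_choice_orbit[OF \<chi> G] .
  then obtain g where "graph_iso g G G" "p = map_edges g r" using p unfolding edge_pair_orbit_def by auto
  then have "graph_iso (f \<circ> g) G G" "map_edges f p = map_edges (f \<circ> g) r"
    using graph_iso_comp f by (auto simp: map_edges_comp)
  then show ?thesis unfolding r edge_pair_orbit_def by auto
qed

lemma equiv_operationsI:
  assumes "edge_doubling C G p" "edge_doubling D G' q" "graph_iso f G G'" "map_edges f p = q"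
  shows "(C, D) \<in> equiv_operations"
  unfolding equiv_operations_def mem_Collect_eq prod.case using assms by metis

theorem lemma5:
  fixes n :: nat
    and S :: "'a ugraph set"
    and \<chi> :: "'a ugraph \<Rightarrow> 'a set set set"
    and T :: "'a operation set"
    and result :: "'a operation \<Rightarrow> 'a ugraph"
    and pair :: "'a operation \<Rightarrow> 'a set set"
  assumes "n > 0"
    and "snark_representatives (n - 2) S"
    and "canonical_choice \<chi>"
    and "operation_representatives S T"
    and "\<And>C. C \<in> T \<Longrightarrow> edge_doubling C (result C) (pair C)"
  shows "(\<forall>C\<in>T. accepted \<chi> (result C) (pair C) \<longrightarrow>
            g4_snark (result C) \<and> card (verts (result C)) = n) \<and>
         (\<forall>G :: 'a ugraph. g4_snark G \<and> card (verts G) = n \<longrightarrow>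
            (\<exists>!C. C \<in> T \<and> isomorphic (result C) G \<and> accepted \<chi> (result C) (pair C)))"
proof -
  have S_snark: "snark H" "card (verts H) = n - 2" if "H \<in> S" for H
    using assms(2) that by (auto simp: snark_representatives_def)
  have S_ex: "\<exists>H'\<in>S. isomorphic H H'" if "snark H" "card (verts H) = n - 2" for H :: "'a ugraph"
    using assms(2) that unfolding snark_representatives_def by metis
  have S_unique: "H = H'" if "H \<in> S" "H' \<in> S" "isomorphic H H'" for H H'
    using assms(2) that S_snark[OF that(1)] isomorphic_refl[of H]
    unfolding snark_representatives_def by metis
  have T_op: "\<exists>H\<in>S. C \<in> operations H" if "C \<in> T" for C
    using assms(4) that by (auto simp: operation_representatives_def)
  have class_unique: "\<exists>!C. C \<in> T \<inter> K" if "H \<in> S" "K \<in> operation_classes H" for H K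
    using assms(4) that by (simp add: operation_representatives_def)
  have domain: "choice_domain (result C)" and card_result: "card (verts (result C)) = n" if "C \<in> T" for C
  proof -
    note CT = that
    obtain H where H: "H \<in> S" "C \<in> operations H" using T_op[OF CT] by auto
    obtain a b c d x y where "doubling H a b c d x y (result C)"
      using doubling_from_operation[OF H(2) assms(5)[OF CT]] .
    then interpret D: doubling H a b c d x y "result C" .
    show "choice_domain (result C)" using D.choice_domain_G snarkD(2)[OF S_snark(1)[OF H(1)]] by metis
    \<comment> \<open>Since \<open>H\<close> has a vertex, \<open>n - 2\<close> is positive, so the
      subtraction is not truncated and adding 2 gives back \<open>n\<close>.\<close>
    have "0 < card (verts H)" using D.path_verts(1) finite_verts[OF D.simple_H] card_gt_0_iff by auto
    then show "card (verts (result C)) = n" using D.card_verts_G S_snark(2)[OF H(1)] by simp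
  qed
  have "g4_snark (result C) \<and> card (verts (result C)) = n"
    if "C \<in> T" "accepted \<chi> (result C) (pair C)" for C
    using domain[OF that(1)] card_result[OF that(1)] that(2)
    by (simp add: g4_snark_def choice_domain_def accepted_def)
  moreover have "\<exists>!C. C \<in> T \<and> isomorphic (result C) G \<and> accepted \<chi> (result C) (pair C)"
    if G: "g4_snark G" "card (verts G) = n" for G :: "'a ugraph"
  proof (rule ex_ex1I)
    have dom_G: "choice_domain G" using g4_snark_choice_domain[OF G(1)] .
    have sG: "simple_graph G" using G(1) cubic_simple by (auto simp: g4_snark_def)
    obtain q where q: "q \<in> E2 G" "\<chi> G = edge_pair_orbit G q"
      using canonical_choice_orbit[OF assms(3) dom_G] .
    have q_\<chi>: "q \<in> \<chi> G"
      unfolding q(2) edge_pair_orbit_def by (intro CollectI exI[of _ id]) (simp add: graph_iso_id map_edges_id)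
    obtain R a b c d x y where R: "snark R" "doubling R a b c d x y G" "q = {{x, y}, {b, c}}"
      using reduction_of_g4_snark[OF G(1) q(1)] .
    interpret D: doubling R a b c d x y G by (rule R(2))
    let ?P = "{{a, b}, {b, c}, {c, d}}"
    obtain H f where H: "H \<in> S" and f: "graph_iso f R H"
      using S_ex[OF R(1)] D.card_verts_G G(2) unfolding isomorphic_def by auto
    note SH = snarkD[OF S_snark(1)[OF H]]
    \<comment> \<open>\<open>R\<close> need not belong to \<open>S\<close>, so its operation is
      carried along \<open>f\<close> to the representative \<open>H\<close>.\<close>
    define D where "D = (H, map_edges f ?P)"
    have D_op: "D \<in> operations H"
      unfolding D_def using operation_image[OF D.operation f SH(1)] SH(4)
        triangle_free_iff_girth[OF cubic_simple[OF SH(1)]] by simp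
    let ?K = "(equiv_operations \<inter> operations H \<times> operations H) `` {D}"
    have "?K \<in> operation_classes H" unfolding operation_classes_def using D_op by (rule quotientI)
    from ex1_implies_ex[OF class_unique[OF H this]]
    obtain C where "C \<in> T \<inter> ?K" by (elim exE)
    then have C: "C \<in> T" "C \<in> ?K" by simp_all
    have C_op: "C \<in> operations H" using C(2) by simp
    have "(D, C) \<in> equiv_operations" using C(2) by simp
    then obtain G1 p1 G2 p2 h where h: "edge_doubling D G1 p1" "edge_doubling C G2 p2"
      "graph_iso h G1 G2" "map_edges h p1 = p2"
      unfolding equiv_operations_def by auto
    \<comment> \<open>The equivalence of \<open>D\<close> and \<open>C\<close> is witnessed by some
      results \<open>G1\<close> and \<open>G2\<close> with their own new vertices; \<open>h1\<close>
      and \<open>h2\<close> link these to \<open>G\<close> and \<open>result C\<close>.\<close>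
    obtain h1 where h1: "graph_iso h1 G G1" "map_edges h1 q = p1"
      using operation_iso[OF D.operation D_op f _ D.edge_doubling h(1)] R(3) by (auto simp: D_def)
    obtain h2 where h2: "graph_iso h2 G2 (result C)" "map_edges h2 p2 = pair C"
      using operation_iso[OF C_op C_op graph_iso_id _ h(2) assms(5)[OF C(1)]] by (auto simp: map_edges_id)
    define g where "g = h2 \<circ> h \<circ> h1"
    have g: "graph_iso g G (result C)" "map_edges g q = pair C"
      using graph_iso_comp[OF h1(1) graph_iso_comp[OF h(3) h2(1)]] h1(2) h(4) h2(2)
      by (simp_all add: g_def map_edges_comp o_assoc)
    have iso: "isomorphic (result C) G"
      using isomorphic_sym[OF sG] g(1) unfolding isomorphic_def by metis
    obtain k where k: "graph_iso k (result C) G" "map_edges k ` \<chi> (result C) = \<chi> G"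
      using canonical_choice_iso[OF assms(3) domain[OF C(1)] dom_G iso] .
    obtain r where r: "r \<in> \<chi> (result C)" "map_edges k r = q" using q_\<chi> unfolding k(2)[symmetric] by auto
    \<comment> \<open>The isomorphism \<open>k\<close> respecting the choice and the isomorphism
      \<open>g\<close> respecting the pairs are unrelated, but \<open>g \<circ> k\<close> is an
      automorphism of \<open>result C\<close>. It takes \<open>r\<close> from the chosen orbit to
      \<open>pair C\<close>.\<close>
    have "map_edges (g \<circ> k) r \<in> \<chi> (result C)"
      using canonical_choice_invariant[OF assms(3) domain[OF C(1)] r(1) graph_iso_comp[OF k(1) g(1)]] .
    then have "pair C \<in> \<chi> (result C)" using r(2) g(2) by (simp add: map_edges_comp)
    moreover have "class2 (result C)"
      using class1_iso[OF sG g(1)] G(1) by (auto simp: g4_snark_def)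
    ultimately have "accepted \<chi> (result C) (pair C)" by (simp add: accepted_def)
    then show "\<exists>C. C \<in> T \<and> isomorphic (result C) G \<and> accepted \<chi> (result C) (pair C)"
      using C(1) iso by metis
  next
    fix C C'
    assume "C \<in> T \<and> isomorphic (result C) G \<and> accepted \<chi> (result C) (pair C)"
      and "C' \<in> T \<and> isomorphic (result C') G \<and> accepted \<chi> (result C') (pair C')"
    then have C: "C \<in> T" "isomorphic (result C) G" "pair C \<in> \<chi> (result C)"
      and C': "C' \<in> T" "isomorphic (result C') G" "pair C' \<in> \<chi> (result C')"
      by (auto simp: accepted_def)
    have "simple_graph (result C')" using domain[OF C'(1)] cubic_simple by (auto simp: choice_domain_def)
    then have "isomorphic (result C) (result C')"
      using isomorphic_trans[OF C(2)] isomorphic_sym C'(2) by metis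
    then obtain k where k: "graph_iso k (result C) (result C')" "map_edges k ` \<chi> (result C) = \<chi> (result C')"
      using canonical_choice_iso[OF assms(3) domain[OF C(1)] domain[OF C'(1)]] by metis
    then have "map_edges k (pair C) \<in> \<chi> (result C')" using C(3) by auto
    then obtain h where h: "graph_iso h (result C') (result C')" "map_edges h (map_edges k (pair C)) = pair C'"
      using canonical_choice_transitive[OF assms(3) domain[OF C'(1)] _ C'(3)] by metis
    define g where "g = h \<circ> k"
    have g: "graph_iso g (result C) (result C')" "map_edges g (pair C) = pair C'"
      using graph_iso_comp[OF k(1) h(1)] h(2) by (simp_all add: g_def map_edges_comp)
    obtain H where H: "H \<in> S" "C \<in> operations H" using T_op[OF C(1)] by auto
    obtain H' where H': "H' \<in> S" "C' \<in> operations H'" using T_op[OF C'(1)] by auto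
    obtain a b c d x y where D: "doubling H a b c d x y (result C)" "pair C = {{x, y}, {b, c}}"
      using doubling_from_operation[OF H(2) assms(5)[OF C(1)]] .
    obtain a' b' c' d' x' y' where D': "doubling H' a' b' c' d' x' y' (result C')" "pair C' = {{x', y'}, {b', c'}}"
      using doubling_from_operation[OF H'(2) assms(5)[OF C'(1)]] .
    let ?K = "(equiv_operations \<inter> operations H \<times> operations H) `` {C}"
    have "isomorphic H H'"
      using doubling_iso_reflects[OF D(1) D'(1) g(1)] g(2) D(2) D'(2) by simp
    then have "C' \<in> operations H" using S_unique[OF H(1) H'(1)] H'(2) by simp
    moreover have "(C, C') \<in> equiv_operations"
      using equiv_operationsI[OF assms(5)[OF C(1)] assms(5)[OF C'(1)] g] .
    \<comment> \<open>Reflexivity of the equivalence at \<open>C\<close> is witnessed by its actual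
      result.\<close>
    moreover have "(C, C) \<in> equiv_operations"
      using equiv_operationsI[OF assms(5)[OF C(1)] assms(5)[OF C(1)] graph_iso_id map_edges_id] .
    ultimately have "C \<in> T \<inter> ?K" "C' \<in> T \<inter> ?K" using C(1) C'(1) H(2) by auto
    moreover have "?K \<in> operation_classes H" unfolding operation_classes_def using H(2) by (rule quotientI)
    ultimately show "C = C'" using class_unique[OF H(1)] by metis
  qed
  ultimately show ?thesis by metis
qed

end
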